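(* Let $F$ be a nonrandom simple graph with $v(F)=k$ nodes, and let $T_F^{\mathrm{inj}}$ be the (injective) subgraph count of $F$ in the $\kappa$-random graph $\mathbb G(n,\kappa)$. Let $\kappa\equiv p$ for $0<p<1$. Then $$\sup_{z\in\mathbb R}\left|\mathbb P\left[\frac{T_F^{\mathrm{inj}}-\mathbb E\{T_F^{\mathrm{inj}}\}}{(\operatorname{Var}\{T_F^{\mathrm{inj}}\})^{1/2}}\le z\right]-\Phi(z)\right|\le Cn^{-1},$$ where $C$ is a constant not depending on $n$.
   Context: For $\kappa\equiv p$ with $p$ a fixed number, $\mathbb G(n,\kappa)$ is the Erdős–Rényi random graph on nodes $1,\dots,n$: the edge indicators $\xi_{i,j}=\xi_{j,i}$, $1\le i<j\le n$, are i.i.d. Bernoulli($p$). The subgraph count is $$T_F^{\mathrm{inj}}=\sum_{1\le\alpha(1)<\dots<\alpha(k)\le n}\ \sum_{H:H\cong F}\ \prod_{(i,j)\in E(H)}\xi_{\alpha(i),\alpha(j)},$$ where $H$ ranges over the $k!/|\mathrm{Aut}(F)|$ graphs on node set $\{1,\dots,k\}$ isomorphic to $F$, $E(H)$ is the edge set of $H$, and $|\mathrm{Aut}(F)|$ is the number of automorphisms of $F$. $\Phi$ is the standard normal distribution function. *)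

theory Defs
  imports "HOL-Probability.Probability"
begin

text \<open>A finite simple graph is a finite node set together with a set of two-element subsets of it.\<close>

definition simple_graph :: "'v set \<Rightarrow> 'v set set \<Rightarrow> bool" where
  "simple_graph V E \<longleftrightarrow> finite V \<and> (\<forall>e\<in>E. e \<subseteq> V \<and> card e = 2)"

definition graph_isomorphic :: "'v set \<Rightarrow> 'v set set \<Rightarrow> 'w set \<Rightarrow> 'w set set \<Rightarrow> bool" where
  "graph_isomorphic V E W D \<longleftrightarrow>
     (\<exists>f. bij_betw f V W \<and> (\<forall>u\<in>V. \<forall>v\<in>V. {u, v} \<in> E \<longleftrightarrow> {f u, f v} \<in> D))"

definition copies :: "'v set \<Rightarrow> 'v set set \<Rightarrow> nat set set set" where
  "copies V E =
     {D. simple_graph {1..card V} D \<and> graph_isomorphic {1..card V} D V E}"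

text \<open>
  Index tuples \<open>\<alpha>(1) < \<dots> < \<alpha>(k)\<close> in \<open>{1..n}\<close>; functions are made extensional
  so that each tuple is represented exactly once.
\<close>

definition increasing_tuples :: "nat \<Rightarrow> nat \<Rightarrow> (nat \<Rightarrow> nat) set" where
  "increasing_tuples k n = {\<alpha> \<in> {1..k} \<rightarrow>\<^sub>E {1..n}. strict_mono_on {1..k} \<alpha>}"

text \<open>Each undirected edge is enumerated once, as the pair \<open>(i, j)\<close> with \<open>i < j\<close>.\<close>

definition inj_subgraph_count ::
  "'v set \<Rightarrow> 'v set set \<Rightarrow> nat \<Rightarrow> (nat \<Rightarrow> nat \<Rightarrow> 'a \<Rightarrow> bool) \<Rightarrow> 'a \<Rightarrow> real" where
  "inj_subgraph_count V E n \<xi> \<omega> =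
     (\<Sum>\<alpha>\<in>increasing_tuples (card V) n. \<Sum>D\<in>copies V E.
        \<Prod>(i, j)\<in>{(i, j). i < j \<and> {i, j} \<in> D}. of_bool (\<xi> (\<alpha> i) (\<alpha> j) \<omega>))"

text \<open>The event \<open>\<xi> i j\<close> is the presence of the edge between \<open>i\<close> and \<open>j\<close>.\<close>

definition erdos_renyi ::
  "nat \<Rightarrow> real \<Rightarrow> 'a measure \<Rightarrow> (nat \<Rightarrow> nat \<Rightarrow> 'a \<Rightarrow> bool) \<Rightarrow> bool" where
  "erdos_renyi n p M \<xi> \<longleftrightarrow>
     prob_space M \<and>
     (\<forall>i\<in>{1..n}. \<forall>j\<in>{1..n}. \<xi> i j = \<xi> j i) \<and>
     prob_space.indep_vars M (\<lambda>_. count_space UNIV) (\<lambda>(i, j). \<xi> i j)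
       {(i, j). 1 \<le> i \<and> i < j \<and> j \<le> n} \<and>
     (\<forall>i j. 1 \<le> i \<and> i < j \<and> j \<le> n \<longrightarrow>
        distr M (count_space UNIV) (\<xi> i j) = measure_pmf (bernoulli_pmf p))"

definition standardized :: "'a measure \<Rightarrow> ('a \<Rightarrow> real) \<Rightarrow> 'a \<Rightarrow> real" where
  "standardized M X \<omega> =
     (X \<omega> - prob_space.expectation M X) / sqrt (prob_space.variance M X)"

definition std_normal_cdf :: "real \<Rightarrow> real" where
  "std_normal_cdf = cdf std_normal_distribution"

end

theory Submission
  imports Defs "HOL-Real_Asymp.Real_Asymp"
begin

text \<open>
  The count is a sum \<open>T\<close> of indicators \<open>H t \<subseteq> A\<close> over the random edge set \<open>A\<close>. Writing \<open>x\<^sub>e\<close> for the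
  centred edge variables and \<open>D\<^sub>e\<close> for the discrete gradient, one has \<open>T - \<^bold>E T = \<Sum>\<^sub>e x\<^sub>e \<Phi>\<^sub>e\<close> with
  \<open>\<Phi>\<^sub>e \<ge> 0\<close> not depending on \<open>e\<close>, and \<open>\<^bold>E[x\<^sub>e \<Phi>\<^sub>e G] = p(1-p) \<^bold>E[\<Phi>\<^sub>e D\<^sub>e G]\<close>. Inserting the Stein solution
  for a half line, whose derivative is the sum of two monotone functions of bounded size up to a constant,
  the Taylor error can be undone by the same integration by parts because \<open>\<Phi>\<^sub>e\<close> and \<open>D\<^sub>e T\<close> are
  nonnegative. Hence the Kolmogorov distance is controlled by the \<open>L\<^sup>1\<close> deviations from their means of
  \<open>Q = p(1-p) \<Sum>\<^sub>e \<Phi>\<^sub>e D\<^sub>e T\<close> and \<open>U = \<Sum>\<^sub>e x\<^sub>e \<Phi>\<^sub>e D\<^sub>e T\<close>, divided by the variance. The gradients of both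
  are bounded by a multiple of \<open>N\<^sup>2\<close>, where \<open>N = O(n\<^bsup>k-2\<^esup>)\<close> bounds the number of placements using a
  given edge, so by the Efron--Stein inequality the deviations are \<open>O(n N\<^sup>2)\<close>. The variance is at least
  of order \<open>n\<^bsup>2k-2\<^esup>\<close> by the Cauchy--Schwarz inequality applied to \<open>T\<close> and \<open>\<Sum>\<^sub>e x\<^sub>e\<close>.
\<close>

subsection \<open>The Stein equation for half lines\<close>

text \<open>Reduces Gaussian tail inequalities to comparing derivatives: the difference of the two
  sides vanishes at minus infinity and does not decrease up to \<open>w\<close>.\<close>

lemma nonneg_if_nondecreasing_from_at_bot:
  fixes f f' :: "real \<Rightarrow> real"
  assumes "\<And>x. x \<le> w \<Longrightarrow> (f has_real_derivative f' x) (at x)"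
    and "\<And>x. x \<le> w \<Longrightarrow> 0 \<le> f' x"
    and "(f \<longlongrightarrow> 0) at_bot"
  shows "0 \<le> f w"
proof -
  have "f y \<le> f w" if "y \<le> w" for y
    using that
  proof (rule DERIV_nonneg_imp_nondecreasing)
    fix x assume "x \<le> w"
    then show "\<exists>d. (f has_real_derivative d) (at x) \<and> 0 \<le> d"
      using assms(1,2) by metis
  qed
  then have "\<forall>\<^sub>F y in at_bot. f y \<le> f w"
    unfolding eventually_at_bot_linorder by metis
  with assms(3) show ?thesis
    by (rule tendsto_upperbound) simp
qed

section \<open>Density and distribution function of the standard normal law\<close>

lemma std_normal_density_deriv:
  "(std_normal_density has_real_derivative - x * std_normal_density x) (at x)"
  unfolding std_normal_density_def
  by (rule derivative_eq_intros refl | simp)+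

lemma std_normal_cdf_deriv:
  "(std_normal_cdf has_real_derivative std_normal_density x) (at x)"
proof -
  interpret real_distribution std_normal_distribution
    by (rule real_dist_normal_dist)
  \<comment> \<open>The base point only has to lie strictly left of \<open>x\<close>, so that
    \<open>x\<close> is interior to the interval on which the fundamental theorem of calculus is
    used.\<close>
  define a where "a = x - 1"
  have cont: "continuous_on T std_normal_density" for T
    unfolding std_normal_density_def by (intro continuous_intros) auto
  have F: "((\<lambda>u. integral {a..u} std_normal_density) has_real_derivative std_normal_density y) (at y within {a..b})"
    if "y \<in> {a..b}" for y b
    using cont that by (rule integral_has_real_derivative)
  have eq: "std_normal_cdf y = std_normal_cdf a + integral {a..y} std_normal_density" if "a < y" for y
  proof -
    have int: "std_normal_density integrable_on {a..y}"
      using cont by (rule integrable_continuous_real)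
    have "emeasure std_normal_distribution {a<..y} = 
        (\<integral>\<^sup>+t. ennreal (std_normal_density t) * indicator {a<..y} t \<partial>lborel)"
      by (subst emeasure_density) auto
    also have "\<dots> = (\<integral>\<^sup>+t. ennreal (std_normal_density t) * indicator {a..y} t \<partial>lborel)"
      by (rule nn_integral_cong_AE, rule AE_I[of _ _ "{a}"]) (auto simp: indicator_def)
    also have "\<dots> = ennreal (integral {a..y} std_normal_density)"
    proof -
      have "((\<lambda>t. if t \<in> {a..y} then std_normal_density t else 0) has_integral
          integral {a..y} std_normal_density) UNIV"
        using int by (subst has_integral_restrict_UNIV) (rule integrable_integral)
      then have "(\<integral>\<^sup>+t. ennreal (if t \<in> {a..y} then std_normal_density t else 0) \<partial>lborel) =
          ennreal (integral {a..y} std_normal_density)"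
        by (intro nn_integral_has_integral_lborel) auto
      then show ?thesis
        by (simp add: indicator_def if_distrib mult.commute of_bool_def cong: if_cong)
    qed
    finally have "measure std_normal_distribution {a<..y} = integral {a..y} std_normal_density"
      using int by (simp add: measure_def integral_nonneg)
    then show ?thesis
      using cdf_diff_eq[OF that] by (simp add: std_normal_cdf_def)
  qed
  have "((\<lambda>u. std_normal_cdf a + integral {a..u} std_normal_density) has_real_derivative
      0 + std_normal_density x) (at x within {a..x+1})"
    by (intro DERIV_add DERIV_const F) (auto simp: a_def)
  then have "((\<lambda>u. std_normal_cdf a + integral {a..u} std_normal_density) has_real_derivative
      std_normal_density x) (at x)"
    by (subst (asm) at_within_interior) (auto simp: a_def)
  then show ?thesis
    by (rule has_field_derivative_transform_within_open[where S = "{a<..}"])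
      (auto simp: eq, auto simp: a_def)
qed

lemma std_normal_cdf_at_bot: "(std_normal_cdf \<longlongrightarrow> 0) at_bot"
  and std_normal_cdf_at_top: "(std_normal_cdf \<longlongrightarrow> 1) at_top"
  and std_normal_cdf_nonneg: "0 \<le> std_normal_cdf x"
  and std_normal_cdf_le_1: "std_normal_cdf x \<le> 1"
proof -
  interpret real_distribution std_normal_distribution
    by (rule real_dist_normal_dist)
  show "(std_normal_cdf \<longlongrightarrow> 0) at_bot" "(std_normal_cdf \<longlongrightarrow> 1) at_top"
    "0 \<le> std_normal_cdf x" "std_normal_cdf x \<le> 1"
    unfolding std_normal_cdf_def
    by (rule cdf_lim_at_bot cdf_lim_at_top_prob cdf_nonneg cdf_bounded_prob)+
qed

lemma std_normal_density_uminus: "std_normal_density (- x) = std_normal_density x"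
  by (simp add: std_normal_density_def)

text \<open>The sum of the two values has derivative zero because the density is even; its limit at
  plus infinity fixes the constant as 1.\<close>

lemma std_normal_cdf_uminus: "std_normal_cdf (- x) = 1 - std_normal_cdf x"
proof -
  let ?g = "\<lambda>x. std_normal_cdf x + std_normal_cdf (- x)"
  have "(?g has_real_derivative 0) (at y)" for y
    by (auto intro!: derivative_eq_intros DERIV_chain2[OF std_normal_cdf_deriv]
        std_normal_cdf_deriv simp: std_normal_density_uminus)
  then have "?g y = ?g x" for y
    using DERIV_isconst_all by blast
  then have "(?g \<longlongrightarrow> ?g x) at_top"
    by (simp add: tendsto_eventually)
  moreover have "(?g \<longlongrightarrow> 1 + 0) at_top"
    by (intro tendsto_add std_normal_cdf_at_top
        filterlim_compose[OF std_normal_cdf_at_bot filterlim_uminus_at_bot_at_top])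
  ultimately have "?g x = 1 + 0"
    using tendsto_unique trivial_limit_at_top_linorder by blast
  then show ?thesis by simp
qed

section \<open>The Mills ratio, mirrored: the value at \<open>w\<close> is the classical ratio at
  \<open>- w\<close>\<close>

definition mills :: "real \<Rightarrow> real" where
  "mills w = std_normal_cdf w / std_normal_density w"

lemma std_normal_density_pos: "0 < std_normal_density x"
  by (simp add: std_normal_density_def)

lemma mills_nonneg: "0 \<le> mills w"
  by (simp add: mills_def std_normal_cdf_nonneg)

lemma mills_deriv: "(mills has_real_derivative 1 + w * mills w) (at w)"
  unfolding mills_def using std_normal_density_pos[of w]
  by (auto intro!: derivative_eq_intros std_normal_cdf_deriv std_normal_density_deriv
      simp: field_simps)

lemma std_normal_density_at_bot:
  "((\<lambda>x. x / (1 + x\<^sup>2) * std_normal_density x) \<longlongrightarrow> 0) at_bot"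
  "((\<lambda>x. 1 / x * std_normal_density x) \<longlongrightarrow> 0) at_bot"
  unfolding std_normal_density_def by real_asymp+

text \<open>The right side is the derivative of \<open>w * mills w\<close>, which is thereby
  monotone. In terms of the distribution function this is the lower tail bound by
  \<open>- w / (1 + w\<^sup>2)\<close> times the density; the difference vanishes at minus infinity
  and has a positive derivative.\<close>

lemma mills_lower: "0 \<le> w + (1 + w\<^sup>2) * mills w"
proof -
  let ?f = "\<lambda>w. std_normal_cdf w + w / (1 + w\<^sup>2) * std_normal_density w"
  have pos: "1 + x\<^sup>2 > 0" for x :: real by (simp add: add_pos_nonneg)
  have "0 \<le> ?f w"
  proof (rule nonneg_if_nondecreasing_from_at_bot[where f = ?f])
    fix x :: real
    define s where "s = 1 + x\<^sup>2"
    have s: "s \<noteq> 0" "x * x = s - 1"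
      using pos[of x] by (simp_all add: s_def power2_eq_square)
    have "((\<lambda>w. w / (1 + w\<^sup>2)) has_real_derivative (1 * s - x * (2 * x)) / (s * s)) (at x)"
      using s(1) by (auto intro!: derivative_eq_intros simp: s_def)
    from DERIV_add[OF std_normal_cdf_deriv DERIV_mult[OF this std_normal_density_deriv]]
    have "(?f has_real_derivative std_normal_density x +
        ((1 * s - x * (2 * x)) / (s * s) * std_normal_density x
          + - x * std_normal_density x * (x / s))) (at x)"
      by (simp add: s_def)
    also have "std_normal_density x + ((1 * s - x * (2 * x)) / (s * s) * std_normal_density x
          + - x * std_normal_density x * (x / s)) =
        std_normal_density x * (1 + (s - 2 * (x * x)) / (s * s) - (x * x) / s)"
      by (simp add: algebra_simps)
    also have "1 + (s - 2 * (x * x)) / (s * s) - (x * x) / s = 2 / s\<^sup>2"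
      unfolding s(2) using s(1) by (simp add: field_simps power2_eq_square)
    finally show "(?f has_real_derivative 2 * std_normal_density x / (1 + x\<^sup>2)\<^sup>2) (at x)"
      by (simp add: s_def mult.commute)
    show "0 \<le> 2 * std_normal_density x / (1 + x\<^sup>2)\<^sup>2" by simp
    have "(?f \<longlongrightarrow> 0 + 0) at_bot"
      by (intro tendsto_add std_normal_cdf_at_bot std_normal_density_at_bot)
    then show "(?f \<longlongrightarrow> 0) at_bot" by simp
  qed
  then have "0 \<le> std_normal_cdf w * (1 + w\<^sup>2) + w * std_normal_density w"
    using pos[of w] by (simp add: field_simps)
  then have "0 \<le> (std_normal_cdf w * (1 + w\<^sup>2) + w * std_normal_density w) / std_normal_density w"
    by (rule divide_nonneg_nonneg) simp
  also have "\<dots> = w + (1 + w\<^sup>2) * mills w"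
    using std_normal_density_pos[of w] by (simp add: mills_def add_divide_distrib)
  finally show ?thesis .
qed

text \<open>This is the classical tail bound by the density over \<open>\<bar>w\<bar>\<close>; the
  difference of the two sides has derivative density over \<open>x\<^sup>2\<close>.\<close>

lemma mills_upper:
  assumes "w < 0"
  shows "- 1 \<le> w * mills w"
proof -
  let ?f = "\<lambda>w. - std_normal_cdf w - 1 / w * std_normal_density w"
  have "0 \<le> ?f w"
  proof (rule nonneg_if_nondecreasing_from_at_bot[where f = ?f])
    fix x :: real assume x: "x \<le> w"
    show "(?f has_real_derivative std_normal_density x / x\<^sup>2) (at x)"
      using x assms
      by (auto intro!: derivative_eq_intros std_normal_cdf_deriv std_normal_density_deriv)
        (auto simp: divide_simps power2_eq_square)
    show "0 \<le> std_normal_density x / x\<^sup>2" by simp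
  next
    have "(?f \<longlongrightarrow> - 0 - 0) at_bot"
      by (intro tendsto_diff tendsto_minus std_normal_cdf_at_bot std_normal_density_at_bot)
    then show "(?f \<longlongrightarrow> 0) at_bot" by simp
  qed
  then have "0 \<le> std_normal_cdf w * w + std_normal_density w"
    using assms by (simp add: field_simps)
  then have "0 \<le> (std_normal_cdf w * w + std_normal_density w) / std_normal_density w"
    by (rule divide_nonneg_nonneg) simp
  also have "\<dots> = w * mills w + 1"
    using std_normal_density_pos[of w] by (simp add: mills_def add_divide_distrib)
  finally show ?thesis by simp
qed

lemma id_times_mills_mono: "u \<le> v \<Longrightarrow> u * mills u \<le> v * mills v"
proof (rule DERIV_nonneg_imp_nondecreasing[where f = "\<lambda>w. w * mills w"])
  fix x :: real
  have "((\<lambda>w. w * mills w) has_real_derivative x + (1 + x\<^sup>2) * mills x) (at x)"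
    by (auto intro!: derivative_eq_intros mills_deriv simp: algebra_simps power2_eq_square)
  then show "\<exists>y. ((\<lambda>w. w * mills w) has_real_derivative y) (at x) \<and> 0 \<le> y"
    using mills_lower by blast
qed

section \<open>The Stein solution, its monotonicity and its Taylor error\<close>

text \<open>The standard solution \<open>f\<close> of the Stein equation f'(w) - w f(w) =
  1[w \<le> z] - \<open>std_normal_cdf z\<close>. Writing the upper tail as
  \<open>std_normal_cdf (- z)\<close> makes the branches mirror images, which agree at
  \<open>z\<close>.\<close>

definition stein_solution :: "real \<Rightarrow> real \<Rightarrow> real" where
  "stein_solution z w =
     (if w \<le> z then mills w * std_normal_cdf (- z) else mills (- w) * std_normal_cdf z)"

lemma stein_solution_above:
  "z \<le> w \<Longrightarrow> stein_solution z w = mills (- w) * std_normal_cdf z"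
  by (cases "w = z") (auto simp: stein_solution_def mills_def std_normal_density_uminus)

lemma stein_solution_below:
  "w \<le> z \<Longrightarrow> stein_solution z w = mills w * std_normal_cdf (- z)"
  by (simp add: stein_solution_def)

text \<open>On each branch this is the monotonicity of \<open>w * mills w\<close>, reflected on the
  upper one; the branches are glued at \<open>z\<close>.\<close>

lemma id_times_stein_solution_mono:
  assumes "u \<le> v"
  shows "u * stein_solution z u \<le> v * stein_solution z v"
proof -
  have below: "u * stein_solution z u \<le> v * stein_solution z v" if "u \<le> v" "v \<le> z" for u v
    using mult_right_mono[OF id_times_mills_mono[OF that(1)] std_normal_cdf_nonneg[of "- z"]] that
    by (simp add: stein_solution_below)
  have above: "u * stein_solution z u \<le> v * stein_solution z v" if "u \<le> v" "z \<le> u" for u v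
    using mult_right_mono[OF id_times_mills_mono[of "- v" "- u"] std_normal_cdf_nonneg[of z]] that
    by (simp add: stein_solution_above)
  show ?thesis
    using below[OF assms] above[OF assms] below[of u z] above[of z v] by linarith
qed

text \<open>On the tail side of each branch \<open>mills_upper\<close> gives the bound at once. If
  \<open>w\<close> lies between 0 and \<open>z\<close>, monotonicity traps the value between the
  value 0 at the origin and the value at \<open>z\<close>.\<close>

lemma id_times_stein_solution_bounded: "\<bar>w * stein_solution z w\<bar> \<le> 1"
proof -
  have b: "\<bar>w * mills w * std_normal_cdf x\<bar> \<le> 1" if "w \<le> 0" for w x
  proof -
    have "\<bar>w * mills w\<bar> \<le> 1"
      using that mills_upper[of w] mills_nonneg[of w]
      by (cases "w = 0") (auto simp: abs_le_iff mult_nonpos_nonneg intro: order_trans[of _ 0])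
    then have "\<bar>w * mills w\<bar> * std_normal_cdf x \<le> 1 * 1"
      by (intro mult_mono std_normal_cdf_le_1 std_normal_cdf_nonneg) auto
    then show ?thesis
      using std_normal_cdf_nonneg[of x] by (simp add: abs_mult)
  qed
  have below: "\<bar>w * stein_solution z w\<bar> \<le> 1" if "w \<le> z" "w \<le> 0" for w
    using b[OF that(2), of "- z"] that by (simp add: stein_solution_below mult.assoc)
  have above: "\<bar>w * stein_solution z w\<bar> \<le> 1" if "z \<le> w" "0 \<le> w" for w
    using b[of "- w" z] that by (simp add: stein_solution_above mult.assoc abs_mult)
  consider "w \<le> z" "w \<le> 0" | "z \<le> w" "0 \<le> w" | "0 < w" "w \<le> z" | "z \<le> w" "w < 0"
    by linarith
  then show ?thesis
  proof cases
    case 3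
    then show ?thesis
      using id_times_stein_solution_mono[of w z z] id_times_stein_solution_mono[of 0 w z] above[of z]
      by (auto simp: abs_le_iff)
  next
    case 4
    then show ?thesis
      using id_times_stein_solution_mono[of z w z] id_times_stein_solution_mono[of w 0 z] below[of z]
      by (auto simp: abs_le_iff)
  qed (auto intro: above below)
qed

text \<open>The solution is smooth on each side of \<open>z\<close>, so the mean value theorem
  applies there, with the slope read off from the Stein equation.\<close>

lemma stein_solution_increment_below:
  assumes "a \<le> b" "b \<le> z"
  obtains c where "a \<le> c" "c \<le> b"
    "stein_solution z b - stein_solution z a =
      (b - a) * (c * stein_solution z c + 1 - std_normal_cdf z)"
proof (cases "a = b")
  case False
  let ?g = "\<lambda>w. mills w * std_normal_cdf (- z)"
  have "(?g has_real_derivative w * ?g w + 1 - std_normal_cdf z) (at w)" for w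
    by (auto intro!: derivative_eq_intros mills_deriv simp: algebra_simps std_normal_cdf_uminus)
  then obtain c where "a < c" "c < b" "?g b - ?g a = (b - a) * (c * ?g c + 1 - std_normal_cdf z)"
    using assms False MVT2[of a b ?g "\<lambda>w. w * ?g w + 1 - std_normal_cdf z"] by auto
  with assms show ?thesis
    by (intro that[of c]) (auto simp: stein_solution_below)
qed (use that in auto)

lemma stein_solution_increment_above:
  assumes "a \<le> b" "z \<le> a"
  obtains c where "a \<le> c" "c \<le> b"
    "stein_solution z b - stein_solution z a = (b - a) * (c * stein_solution z c - std_normal_cdf z)"
proof (cases "a = b")
  case False
  let ?g = "\<lambda>w. mills (- w) * std_normal_cdf z"
  have "(?g has_real_derivative w * ?g w - std_normal_cdf z) (at w)" for w
    by (auto intro!: derivative_eq_intros DERIV_chain2[OF mills_deriv] simp: algebra_simps)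
  then obtain c where "a < c" "c < b" "?g b - ?g a = (b - a) * (c * ?g c - std_normal_cdf z)"
    using assms False MVT2[of a b ?g "\<lambda>w. w * ?g w - std_normal_cdf z"] by auto
  with assms show ?thesis
    by (intro that[of c]) (auto simp: stein_solution_above)
qed (use that in auto)

text \<open>The slope is the nondecreasing \<open>w * stein_solution z w\<close> plus a
  nonincreasing indicator. Evaluating these two parts at opposite endpoints bounds it over the whole
  interval.\<close>

lemma stein_solution_increment_bounds:
  assumes "a \<le> b"
  shows "stein_solution z b - stein_solution z a
      \<le> (b - a) * (b * stein_solution z b + of_bool (a \<le> z) - std_normal_cdf z)" (is ?upper)
    and "(b - a) * (a * stein_solution z a + of_bool (b \<le> z) - std_normal_cdf z)
      \<le> stein_solution z b - stein_solution z a" (is ?lower)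
proof -
  let ?h = "\<lambda>w. w * stein_solution z w"
  have "?upper \<and> ?lower"
  proof -
    consider "b \<le> z" | "z < a" | "a \<le> z" "z < b" using assms by linarith
    then show ?thesis
    proof cases
      case 1
      obtain c where "a \<le> c" "c \<le> b"
        "stein_solution z b - stein_solution z a = (b - a) * (?h c + 1 - std_normal_cdf z)"
        using stein_solution_increment_below[OF assms 1] .
      then show ?thesis using 1 assms
        by (auto intro!: mult_left_mono id_times_stein_solution_mono)
    next
      case 2
      obtain c where "a \<le> c" "c \<le> b"
        "stein_solution z b - stein_solution z a = (b - a) * (?h c - std_normal_cdf z)"
        using stein_solution_increment_above[of a b z] assms 2 by auto
      then show ?thesis using 2 assms
        by (auto intro!: mult_left_mono id_times_stein_solution_mono)
    next
      case 3
      \<comment> \<open>The slope jumps at \<open>z\<close>, so the interval is split there and both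
        pieces are compared with the same extreme slopes.\<close>
      obtain c where c: "a \<le> c" "c \<le> z"
        "stein_solution z z - stein_solution z a = (z - a) * (?h c + 1 - std_normal_cdf z)"
        using stein_solution_increment_below[of a z z] 3 by auto
      obtain d where d: "z \<le> d" "d \<le> b"
        "stein_solution z b - stein_solution z z = (b - z) * (?h d - std_normal_cdf z)"
        using stein_solution_increment_above[of z b z] 3 by auto
      have "(z - a) * (?h c + 1 - std_normal_cdf z) \<le> (z - a) * (?h b + 1 - std_normal_cdf z)"
        "(b - z) * (?h d - std_normal_cdf z) \<le> (b - z) * (?h b + 1 - std_normal_cdf z)"
        "(z - a) * (?h a - std_normal_cdf z) \<le> (z - a) * (?h c + 1 - std_normal_cdf z)"
        "(b - z) * (?h a - std_normal_cdf z) \<le> (b - z) * (?h d - std_normal_cdf z)"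
        using c d 3 id_times_stein_solution_mono[of c b z] id_times_stein_solution_mono[of d b z]
          id_times_stein_solution_mono[of a c z] id_times_stein_solution_mono[of a d z]
        by (auto intro!: mult_left_mono)
      with c(3) d(3) 3 show ?thesis
        by (simp add: algebra_simps)
    qed
  qed
  then show ?upper ?lower by auto
qed

text \<open>Here \<open>w * stein_solution z w + of_bool (w \<le> z) - std_normal_cdf z\<close> is the derivative of the solution.\<close>

lemma stein_solution_taylor:
  fixes z :: real
  defines "g \<equiv> (\<lambda>w. w * stein_solution z w + of_bool (w \<le> z) - std_normal_cdf z)"
    and "k \<equiv> (\<lambda>w. w * stein_solution z w - of_bool (w \<le> z))"
  assumes "a \<le> b" "w = a \<or> w = b"
  shows "\<bar>stein_solution z b - stein_solution z a - (b - a) * g w\<bar> \<le> (b - a) * (k b - k a)"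
proof -
  let ?f = "stein_solution z"
  let ?U = "(b - a) * (b * ?f b + of_bool (a \<le> z) - std_normal_cdf z)"
  let ?L = "(b - a) * (a * ?f a + of_bool (b \<le> z) - std_normal_cdf z)"
  note m = id_times_stein_solution_mono[OF assms(3), of z]
  have o: "(of_bool (b \<le> z) :: real) \<le> of_bool (a \<le> z)" using assms(3) by auto
  \<comment> \<open>The increment and its linearisation both lie between \<open>?L\<close> and
    \<open>?U\<close>, so they differ by at most the gap, which is an increment of the nondecreasing
    \<open>k\<close>.\<close>
  have "(b - a) * g w \<le> ?U" "?L \<le> (b - a) * g w"
    using assms(3,4) m o by (auto simp: g_def intro!: mult_left_mono)
  moreover have "?U - ?L = (b - a) * (k b - k a)"
    by (simp add: k_def algebra_simps)
  ultimately show ?thesis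
    using stein_solution_increment_bounds[OF assms(3), of z] by linarith
qed

subsection \<open>Calculus on the biased discrete cube\<close>

text \<open>The mean of \<open>G\<close> at a random subset of \<open>S\<close> containing each
  element independently with probability \<open>p\<close>, as a finite sum free of measurability
  questions.\<close>

definition cube_expectation :: "real \<Rightarrow> 'e set \<Rightarrow> ('e set \<Rightarrow> real) \<Rightarrow> real" where
  "cube_expectation p S G = (\<Sum>A\<in>Pow S. p ^ card A * (1 - p) ^ card (S - A) * G A)"

text \<open>The value is the same whether or not \<open>e\<close> lies in \<open>A\<close>, so the
  gradient is itself a function not depending on coordinate \<open>e\<close>.\<close>

definition gradient :: "'e \<Rightarrow> ('e set \<Rightarrow> real) \<Rightarrow> 'e set \<Rightarrow> real" where
  "gradient e G A = G (insert e A) - G (A - {e})"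

lemma cube_expectation_add:
  "cube_expectation p S (\<lambda>A. F A + G A) = cube_expectation p S F + cube_expectation p S G"
  by (simp add: cube_expectation_def algebra_simps sum.distrib)

lemma cube_expectation_diff:
  "cube_expectation p S (\<lambda>A. F A - G A) = cube_expectation p S F - cube_expectation p S G"
  by (simp add: cube_expectation_def algebra_simps sum_subtractf)

lemma cube_expectation_cmult:
  "cube_expectation p S (\<lambda>A. c * G A) = c * cube_expectation p S G"
  by (simp add: cube_expectation_def algebra_simps sum_distrib_left)

lemma cube_expectation_divide:
  "cube_expectation p S (\<lambda>A. G A / c) = cube_expectation p S G / c"
  by (simp add: cube_expectation_def sum_divide_distrib)

lemma cube_expectation_sum:
  "cube_expectation p S (\<lambda>A. \<Sum>i\<in>J. G i A) = (\<Sum>i\<in>J. cube_expectation p S (G i))"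
  unfolding cube_expectation_def sum_distrib_left by (rule sum.swap)

text \<open>Conditioning on the presence of \<open>e\<close>; this drives the inductions over
  \<open>S\<close>.\<close>

lemma cube_expectation_insert:
  assumes "finite S" "e \<notin> S"
  shows "cube_expectation p (insert e S) G =
    p * cube_expectation p S (\<lambda>A. G (insert e A)) + (1 - p) * cube_expectation p S G"
proof -
  let ?w = "\<lambda>A. p ^ card A * (1 - p) ^ card (insert e S - A) * G A"
  have fin: "finite A" if "A \<subseteq> S" for A
    using that assms(1) finite_subset by blast
  have "cube_expectation p (insert e S) G = sum ?w (Pow S) + sum ?w (insert e ` Pow S)"
    unfolding cube_expectation_def Pow_insert
    using assms by (intro sum.union_disjoint) auto
  also have "sum ?w (insert e ` Pow S) = (\<Sum>A\<in>Pow S. ?w (insert e A))"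
    using assms(2) by (subst sum.reindex) (auto simp: inj_on_def)
  also have "\<dots> = p * cube_expectation p S (\<lambda>A. G (insert e A))"
    unfolding cube_expectation_def sum_distrib_left
  proof (rule sum.cong)
    fix A assume "A \<in> Pow S"
    then have "insert e S - insert e A = S - A" "card (insert e A) = Suc (card A)"
      using assms fin by (auto intro!: card_insert_disjoint)
    then show "?w (insert e A) = p * (p ^ card A * (1 - p) ^ card (S - A) * G (insert e A))"
      by simp
  qed simp
  also have "sum ?w (Pow S) = (1 - p) * cube_expectation p S G"
    unfolding cube_expectation_def sum_distrib_left
  proof (rule sum.cong)
    fix A assume "A \<in> Pow S"
    then have "insert e S - A = insert e (S - A)" "card (insert e (S - A)) = Suc (card (S - A))"
      using assms by (auto intro!: card_insert_disjoint)
    then show "?w A = (1 - p) * (p ^ card A * (1 - p) ^ card (S - A) * G A)"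
      by simp
  qed simp
  finally show ?thesis by simp
qed

lemma cube_expectation_const:
  assumes "finite S"
  shows "cube_expectation p S (\<lambda>A. c) = c"
  using assms
proof induction
  case empty
  then show ?case by (simp add: cube_expectation_def)
next
  case (insert e S)
  then show ?case by (simp add: cube_expectation_insert algebra_simps)
qed

lemma cube_expectation_cong:
  assumes "\<And>A. A \<subseteq> S \<Longrightarrow> F A = G A"
  shows "cube_expectation p S F = cube_expectation p S G"
  unfolding cube_expectation_def using assms by (intro sum.cong) auto

lemma gradient_cmult: "gradient e (\<lambda>A. c * G A) A = c * gradient e G A"
  by (simp add: gradient_def algebra_simps)

lemma gradient_sum: "gradient e (\<lambda>A. \<Sum>i\<in>J. G i A) A = (\<Sum>i\<in>J. gradient e (G i) A)"
  by (simp add: gradient_def sum_subtractf)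

text \<open>The discrete Leibniz rule, with one factor taken at \<open>insert e A\<close> and the
  other at \<open>A - {e}\<close>.\<close>

lemma gradient_mult_bound:
  assumes "\<And>A. \<bar>F A\<bar> \<le> a" "\<And>A. \<bar>G A\<bar> \<le> b" "\<bar>gradient e F A\<bar> \<le> c" "\<bar>gradient e G A\<bar> \<le> d"
  shows "\<bar>gradient e (\<lambda>A. F A * G A) A\<bar> \<le> c * b + a * d"
proof -
  have "gradient e (\<lambda>A. F A * G A) A =
      gradient e F A * G (insert e A) + F (A - {e}) * gradient e G A"
    by (simp add: gradient_def algebra_simps)
  also have "\<bar>\<dots>\<bar> \<le> \<bar>gradient e F A\<bar> * \<bar>G (insert e A)\<bar> + \<bar>F (A - {e})\<bar> * \<bar>gradient e G A\<bar>"
    by (metis abs_mult abs_triangle_ineq)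
  also have "\<dots> \<le> c * b + a * d"
  proof -
    have "0 \<le> a" "0 \<le> b" "0 \<le> c"
      using assms(1)[of A] assms(2)[of A] assms(3) by linarith+
    then show ?thesis
      using assms by (intro add_mono mult_mono) auto
  qed
  finally show ?thesis .
qed

section \<open>Moment inequalities and integration by parts\<close>

context
  fixes p :: real and S :: "'e set"
  assumes p: "0 < p" "p < 1" and S: "finite S"
begin

lemma cube_expectation_mono:
  assumes "\<And>A. A \<subseteq> S \<Longrightarrow> F A \<le> G A"
  shows "cube_expectation p S F \<le> cube_expectation p S G"
  unfolding cube_expectation_def using assms p by (intro sum_mono mult_left_mono) auto

lemma cube_expectation_abs:
  "\<bar>cube_expectation p S F\<bar> \<le> cube_expectation p S (\<lambda>A. \<bar>F A\<bar>)"
proof -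
  have "\<bar>cube_expectation p S F\<bar> \<le> (\<Sum>A\<in>Pow S. \<bar>p ^ card A * (1 - p) ^ card (S - A) * F A\<bar>)"
    unfolding cube_expectation_def by (rule sum_abs)
  also have "\<dots> = cube_expectation p S (\<lambda>A. \<bar>F A\<bar>)"
    using p by (simp add: cube_expectation_def abs_mult)
  finally show ?thesis .
qed

lemma cube_expectation_cauchy_schwarz:
  "(cube_expectation p S (\<lambda>A. F A * G A))\<^sup>2
    \<le> cube_expectation p S (\<lambda>A. (F A)\<^sup>2) * cube_expectation p S (\<lambda>A. (G A)\<^sup>2)"
proof -
  define w where "w A = p ^ card A * (1 - p) ^ card (S - A)" for A
  have w: "0 \<le> w A" for A using p by (simp add: w_def)
  have "(\<Sum>A\<in>Pow S. (sqrt (w A) * F A) * (sqrt (w A) * G A))\<^sup>2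
      \<le> (\<Sum>A\<in>Pow S. (sqrt (w A) * F A)\<^sup>2) * (\<Sum>A\<in>Pow S. (sqrt (w A) * G A)\<^sup>2)"
    by (rule Cauchy_Schwarz_ineq_sum)
  moreover have "(sqrt (w A) * F A) * (sqrt (w A) * G A) = w A * (F A * G A)" for A
    using real_sqrt_mult_self[of "w A"] w[of A] by (simp add: mult.assoc mult.left_commute)
  ultimately show ?thesis
    using w by (simp add: cube_expectation_def power_mult_distrib flip: w_def)
qed

lemma cube_expectation_abs_le_L2:
  "cube_expectation p S (\<lambda>A. \<bar>F A\<bar>) \<le> sqrt (cube_expectation p S (\<lambda>A. (F A)\<^sup>2))"
  using cube_expectation_cauchy_schwarz[of "\<lambda>A. \<bar>F A\<bar>" "\<lambda>_. 1"]
  by (intro real_le_rsqrt) (simp add: cube_expectation_const S)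

text \<open>Given the other coordinates, the centred variable is \<open>1 - p\<close> with weight
  \<open>p\<close> and \<open>- p\<close> with weight \<open>1 - p\<close>; the two values of
  \<open>G\<close> thus enter with weights of size \<open>p * (1 - p)\<close> and opposite
  sign.\<close>

lemma cube_integration_by_parts:
  assumes "e \<in> S" and inv: "\<And>A. F (insert e A) = F (A - {e})"
  shows "cube_expectation p S (\<lambda>A. (of_bool (e \<in> A) - p) * F A * G A) =
    p * (1 - p) * cube_expectation p S (\<lambda>A. F A * gradient e G A)"
proof -
  define R where "R = S - {e}"
  have R: "S = insert e R" "finite R" "e \<notin> R"
    using assms(1) S by (auto simp: R_def)
  have F: "F (insert e A) = F A" if "e \<notin> A" for A
    using inv[of A] that by simp
  have D: "A - {e} = A" if "A \<subseteq> R" for A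
    using that R(3) by blast
  have "cube_expectation p S (\<lambda>A. (of_bool (e \<in> A) - p) * F A * G A) =
      p * cube_expectation p R (\<lambda>A. (1 - p) * (F A * G (insert e A)))
      + (1 - p) * cube_expectation p R (\<lambda>A. - p * (F A * G A))"
    unfolding R(1) cube_expectation_insert[OF R(2,3)]
    using R(3) F by (intro arg_cong2[of _ _ _ _ "(+)"] arg_cong[of _ _ "(*) _"]
        cube_expectation_cong) (auto simp: subset_iff)
  also have "\<dots> = p * (1 - p) * cube_expectation p R (\<lambda>A. F A * G (insert e A) - F A * G A)"
    unfolding cube_expectation_cmult cube_expectation_diff by (simp add: algebra_simps)
  also have "\<dots> = p * (1 - p) * cube_expectation p R (\<lambda>A. F A * gradient e G A)"
    using R(3) by (intro arg_cong[of _ _ "(*) _"] cube_expectation_cong)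
      (simp add: gradient_def right_diff_distrib D)
  \<comment> \<open>The integrand does not depend on \<open>e\<close>, so averaging over that
    coordinate restores the expectation over all of \<open>S\<close>.\<close>
  also have "cube_expectation p R (\<lambda>A. F A * gradient e G A) =
      cube_expectation p R (\<lambda>A. F (insert e A) * gradient e G (insert e A))"
  proof (rule cube_expectation_cong)
    fix A assume "A \<subseteq> R"
    then have "e \<notin> A" using R(3) by blast
    then show "F A * gradient e G A = F (insert e A) * gradient e G (insert e A)"
      by (simp add: gradient_def F)
  qed
  then have "cube_expectation p R (\<lambda>A. F A * gradient e G A) =
      cube_expectation p S (\<lambda>A. F A * gradient e G A)"
    unfolding R(1) cube_expectation_insert[OF R(2,3)] by (simp add: algebra_simps)
  finally show ?thesis .
qed

end

text \<open>Induction by the law of total variance: averaging out \<open>e\<close> gives a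
  conditional mean obeying the same gradient bounds, and the conditional variance given the rest is
  at most \<open>c\<^sup>2\<close>.\<close>

lemma cube_efron_stein:
  fixes c :: real
  assumes "0 < p" "p < 1" "finite S" "0 \<le> c" "\<And>e A. e \<in> S \<Longrightarrow> \<bar>gradient e G A\<bar> \<le> c"
  shows "cube_expectation p S (\<lambda>A. (G A - cube_expectation p S G)\<^sup>2) \<le> card S * c\<^sup>2"
proof -
  have variance: "cube_expectation p S (\<lambda>A. (G A - cube_expectation p S G)\<^sup>2) =
      cube_expectation p S (\<lambda>A. (G A)\<^sup>2) - (cube_expectation p S G)\<^sup>2"
    if "finite S" for S and G :: "'a set \<Rightarrow> real"
  proof -
    define m where "m = cube_expectation p S G"
    have "(\<lambda>A. (G A - m)\<^sup>2) = (\<lambda>A. (G A)\<^sup>2 - (2 * m) * G A + m\<^sup>2)"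
      by (simp add: fun_eq_iff power2_eq_square algebra_simps)
    then have "cube_expectation p S (\<lambda>A. (G A - m)\<^sup>2) =
        cube_expectation p S (\<lambda>A. (G A)\<^sup>2) - (2 * m) * m + m\<^sup>2"
      by (simp only: cube_expectation_add cube_expectation_diff cube_expectation_const[OF that]
          cube_expectation_cmult flip: m_def)
    then show ?thesis
      by (simp add: m_def power2_eq_square)
  qed
  have "cube_expectation p S (\<lambda>A. (G A)\<^sup>2) - (cube_expectation p S G)\<^sup>2 \<le> card S * c\<^sup>2"
    using assms(3,5)
  proof (induction S arbitrary: G)
    case empty
    then show ?case by (simp add: cube_expectation_def)
  next
    case (insert e S)
    let ?E = "cube_expectation p S"
    define G1 where "G1 A = G (insert e A)" for A
    define Gm where "Gm A = p * G1 A + (1 - p) * G A" for A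
    have grad_Gm: "\<bar>gradient f Gm A\<bar> \<le> c" if "f \<in> S" for f A
    proof -
      have "f \<noteq> e" using that insert.hyps by auto
      then have "gradient f Gm A = p * gradient f G (insert e A) + (1 - p) * gradient f G A"
        by (simp add: gradient_def Gm_def G1_def algebra_simps insert_commute insert_Diff_if)
      also have "\<bar>\<dots>\<bar> \<le> p * \<bar>gradient f G (insert e A)\<bar> + (1 - p) * \<bar>gradient f G A\<bar>"
        using assms(1,2) by (intro order.trans[OF abs_triangle_ineq]) (simp add: abs_mult)
      also have "\<dots> \<le> p * c + (1 - p) * c"
        using assms(1,2) that insert.prems by (intro add_mono mult_left_mono) auto
      finally show ?thesis by (simp add: algebra_simps)
    qed
    \<comment> \<open>Second moment over coordinate \<open>e\<close> as squared conditional mean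
      plus conditional variance.\<close>
    have sq: "p * (G1 A)\<^sup>2 + (1 - p) * (G A)\<^sup>2 = (Gm A)\<^sup>2 + p * (1 - p) * (G1 A - G A)\<^sup>2" for A
      by (simp add: Gm_def power2_eq_square algebra_simps)
    have "cube_expectation p (insert e S) (\<lambda>A. (G A)\<^sup>2) = ?E (\<lambda>A. p * (G1 A)\<^sup>2 + (1 - p) * (G A)\<^sup>2)"
      using insert.hyps
      by (simp add: cube_expectation_insert cube_expectation_add cube_expectation_cmult G1_def)
    also have "\<dots> = ?E (\<lambda>A. (Gm A)\<^sup>2) + ?E (\<lambda>A. p * (1 - p) * (G1 A - G A)\<^sup>2)"
      unfolding sq by (rule cube_expectation_add)
    also have "?E (\<lambda>A. p * (1 - p) * (G1 A - G A)\<^sup>2) \<le> ?E (\<lambda>A. c\<^sup>2)"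
    proof (rule cube_expectation_mono[OF assms(1,2) insert.hyps(1)])
      fix A assume "A \<subseteq> S"
      then have "A - {e} = A"
        using insert.hyps(2) by blast
      then have "\<bar>G1 A - G A\<bar> \<le> c"
        using insert.prems[of e A] by (simp add: gradient_def G1_def)
      then have "(G1 A - G A)\<^sup>2 \<le> c\<^sup>2"
        using power_mono[of "\<bar>G1 A - G A\<bar>" c 2] by simp
      moreover have "p * (1 - p) \<le> 1"
        using assms(1,2) by (simp add: mult_le_one)
      ultimately show "p * (1 - p) * (G1 A - G A)\<^sup>2 \<le> c\<^sup>2"
        using mult_mono[of "p * (1 - p)" 1 "(G1 A - G A)\<^sup>2" "c\<^sup>2"] by simp
    qed
    also have "\<dots> = c\<^sup>2" by (rule cube_expectation_const[OF insert.hyps(1)])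
    also have "?E (\<lambda>A. (Gm A)\<^sup>2) \<le> card S * c\<^sup>2 + (?E Gm)\<^sup>2"
      using insert.IH[of Gm] grad_Gm by simp
    also have "?E Gm = cube_expectation p (insert e S) G"
      using insert.hyps
      by (simp add: cube_expectation_insert Gm_def[abs_def] G1_def cube_expectation_add
          cube_expectation_cmult)
    finally show ?case
      using insert.hyps by (simp add: algebra_simps)
  qed
  with variance[OF assms(3)] show ?thesis by simp
qed

text \<open>
  Splitting off the edges of \<open>H\<close> one at a time writes the centred indicator of \<open>H \<subseteq> A\<close> as a sum over
  \<open>e \<in> H\<close> of the centred edge variable times a nonnegative weight that does not involve \<open>e\<close>.
\<close>

lemma centred_indicator_decomposition:
  fixes H :: "'e set" and p :: real
  assumes "finite H" "0 < p" "p < 1"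
  obtains \<phi> :: "'e \<Rightarrow> 'e set \<Rightarrow> real" where
    "\<And>A. (\<Sum>e\<in>H. (of_bool (e \<in> A) - p) * \<phi> e A) = of_bool (H \<subseteq> A) - p ^ card H"
    "\<And>e A. 0 \<le> \<phi> e A" "\<And>e A. \<phi> e A \<le> 1"
    "\<And>e f A. f = e \<or> f \<notin> H \<Longrightarrow> \<phi> e (insert f A) = \<phi> e (A - {f})"
proof -
  have "\<exists>\<phi> :: 'e \<Rightarrow> 'e set \<Rightarrow> real.
      (\<forall>A. (\<Sum>e\<in>H. (of_bool (e \<in> A) - p) * \<phi> e A) = of_bool (H \<subseteq> A) - p ^ card H) \<and>
      (\<forall>e A. 0 \<le> \<phi> e A \<and> \<phi> e A \<le> 1) \<and>
      (\<forall>e f A. f = e \<or> f \<notin> H \<longrightarrow> \<phi> e (insert f A) = \<phi> e (A - {f}))"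
    using assms(1)
  proof induction
    case empty
    show ?case by (intro exI[of _ "\<lambda>_ _. 0"]) simp
  next
    case (insert h H)
    then obtain \<phi> :: "'e \<Rightarrow> 'e set \<Rightarrow> real" where \<phi>:
      "\<And>A. (\<Sum>e\<in>H. (of_bool (e \<in> A) - p) * \<phi> e A) = of_bool (H \<subseteq> A) - p ^ card H"
      "\<And>e A. 0 \<le> \<phi> e A \<and> \<phi> e A \<le> 1"
      "\<And>e f A. f = e \<or> f \<notin> H \<Longrightarrow> \<phi> e (insert f A) = \<phi> e (A - {f})"
      by blast
    \<comment> \<open>From x y - p q = (x - p) y + p (y - q), with x, y the indicators of
      \<open>h \<in> A\<close>, \<open>H \<subseteq> A\<close> and q = \<open>p ^ card H\<close>:
      the new edge gets weight y and the old weights are scaled by \<open>p\<close>.\<close>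
    define \<psi> where "\<psi> e A = (if e = h then of_bool (H \<subseteq> A) else p * \<phi> e A)" for e A
    have "(\<Sum>e\<in>insert h H. (of_bool (e \<in> A) - p) * \<psi> e A) =
        of_bool (insert h H \<subseteq> A) - p ^ card (insert h H)" for A
    proof -
      have "(\<Sum>e\<in>H. (of_bool (e \<in> A) - p) * \<psi> e A) =
          (\<Sum>e\<in>H. p * ((of_bool (e \<in> A) - p) * \<phi> e A))"
        using insert.hyps by (intro sum.cong) (auto simp: \<psi>_def)
      also have "\<dots> = p * (of_bool (H \<subseteq> A) - p ^ card H)"
        by (simp only: \<phi>(1) flip: sum_distrib_left)
      finally have "(\<Sum>e\<in>insert h H. (of_bool (e \<in> A) - p) * \<psi> e A) =
          (of_bool (h \<in> A) - p) * of_bool (H \<subseteq> A) + p * (of_bool (H \<subseteq> A) - p ^ card H)"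
        using insert.hyps by (simp add: \<psi>_def)
      also have "\<dots> = of_bool (insert h H \<subseteq> A) - p ^ card (insert h H)"
        using insert.hyps by (cases "h \<in> A"; cases "H \<subseteq> A") (simp_all add: algebra_simps)
      finally show ?thesis .
    qed
    moreover have "0 \<le> \<psi> e A \<and> \<psi> e A \<le> 1" for e A
      using \<phi>(2)[of e A] assms(2,3) by (auto simp: \<psi>_def intro: mult_le_one)
    moreover have "\<psi> e (insert f A) = \<psi> e (A - {f})" if "f = e \<or> f \<notin> insert h H" for e f A
    proof (cases "e = h")
      case True
      then have "f \<notin> H" using that insert.hyps by auto
      then show ?thesis using True by (auto simp: \<psi>_def)
    next
      case False
      then show ?thesis using that \<phi>(3)[of f e A] by (auto simp: \<psi>_def)
    qed
    ultimately show ?case by blast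
  qed
  then show ?thesis using that by blast
qed

subsection \<open>Kolmogorov bound for sums of monotone indicators\<close>

text \<open>In the application \<open>t\<close> runs over placements of copies of the graph and
  \<open>H t\<close> is the edge set of the placement; \<open>m\<close> bounds the edges per
  placement and \<open>N\<close> the placements through one edge.\<close>

locale cube_indicator_sum =
  fixes p :: real and S :: "'e set" and J :: "'t set" and H :: "'t \<Rightarrow> 'e set" and m N :: real
  assumes p: "0 < p" "p < 1"
    and S: "finite S" and J: "finite J"
    and H: "\<And>t. t \<in> J \<Longrightarrow> H t \<subseteq> S"
    and card_H: "\<And>t. t \<in> J \<Longrightarrow> card (H t) \<le> m"
    and N: "\<And>e. e \<in> S \<Longrightarrow> card {t \<in> J. e \<in> H t} \<le> N"
    and nonneg: "0 \<le> m" "0 \<le> N"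
begin

abbreviation expect :: "('e set \<Rightarrow> real) \<Rightarrow> real" where
  "expect \<equiv> cube_expectation p S"

definition T :: "'e set \<Rightarrow> real" where
  "T A = (\<Sum>t\<in>J. of_bool (H t \<subseteq> A))"

definition var_T :: real where
  "var_T = expect (\<lambda>A. (T A - expect T)\<^sup>2)"

text \<open>The number of \<open>t\<close> whose \<open>H t\<close> contains both \<open>e\<close>
  and \<open>f\<close>; it measures how strongly a quantity local to \<open>e\<close> can react to
  \<open>f\<close>.\<close>

definition joint_degree :: "'e \<Rightarrow> 'e \<Rightarrow> real" where
  "joint_degree e f = (\<Sum>t\<in>J. of_bool (e \<in> H t) * of_bool (f \<in> H t))"

lemma joint_degree_same:
  assumes "e \<in> S"
  shows "joint_degree e e \<le> N"
proof -
  have "joint_degree e e = card {t \<in> J. e \<in> H t}"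
    using J by (simp add: joint_degree_def Int_def flip: of_bool_conj)
  with N[OF assms] show ?thesis by simp
qed

lemma joint_degree_commute: "joint_degree e f = joint_degree f e"
  by (simp add: joint_degree_def mult.commute)

lemma joint_degree_nonneg: "0 \<le> joint_degree e f"
  by (simp add: joint_degree_def sum_nonneg)

lemma finite_H: "t \<in> J \<Longrightarrow> finite (H t)"
  using H S finite_subset by blast

text \<open>Double counting: each of the at most \<open>N\<close> sets through \<open>e\<close> is
  counted once for each of its at most \<open>m\<close> elements.\<close>

lemma sum_joint_degree:
  assumes "e \<in> S"
  shows "(\<Sum>f\<in>S. joint_degree e f) \<le> m * N"
proof -
  have "(\<Sum>f\<in>S. joint_degree e f) = (\<Sum>t\<in>J. of_bool (e \<in> H t) * (\<Sum>f\<in>S. of_bool (f \<in> H t)))"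
    unfolding joint_degree_def sum_distrib_left by (rule sum.swap)
  also have "\<dots> \<le> (\<Sum>t\<in>J. of_bool (e \<in> H t) * m)"
  proof (intro sum_mono mult_left_mono)
    fix t assume "t \<in> J"
    then have "S \<inter> {f. f \<in> H t} = H t" using H by auto
    then show "(\<Sum>f\<in>S. of_bool (f \<in> H t)) \<le> m"
      using S card_H[OF \<open>t \<in> J\<close>] by simp
  qed simp
  also have "\<dots> = joint_degree e e * m"
    by (simp add: joint_degree_def sum_distrib_right flip: of_bool_conj)
  also have "\<dots> \<le> N * m"
    using joint_degree_same[OF assms] nonneg by (intro mult_right_mono)
  finally show ?thesis by (simp add: mult.commute)
qed

text \<open>Treats the weights of the decomposition and the gradient of \<open>T\<close> alike. Each
  summand lies in [0,1] and sees only \<open>H t\<close>, so flipping \<open>f\<close> affects just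
  the \<open>t\<close> containing both \<open>e\<close> and \<open>f\<close>.\<close>

lemma local_sum_bounds:
  fixes e :: 'e and \<phi> :: "'t \<Rightarrow> 'e set \<Rightarrow> real"
  assumes "\<And>t A. t \<in> J \<Longrightarrow> 0 \<le> \<phi> t A \<and> \<phi> t A \<le> 1"
    and "\<And>t f A. t \<in> J \<Longrightarrow> f \<notin> H t \<Longrightarrow> \<phi> t (insert f A) = \<phi> t (A - {f})"
  defines "G \<equiv> \<lambda>A. \<Sum>t\<in>J. of_bool (e \<in> H t) * \<phi> t A"
  shows "0 \<le> G A" "e \<in> S \<Longrightarrow> G A \<le> N" "\<bar>gradient f G A\<bar> \<le> joint_degree e f"
proof -
  show "0 \<le> G A"
    unfolding G_def using assms(1) by (intro sum_nonneg) auto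
  have "G A \<le> joint_degree e e"
    unfolding G_def joint_degree_def using assms(1) by (intro sum_mono) auto
  then show "G A \<le> N" if "e \<in> S"
    using joint_degree_same[OF that] by simp
  have "\<bar>gradient f (\<phi> t) A\<bar> \<le> of_bool (f \<in> H t)" if "t \<in> J" for t
    using assms(1)[OF that, of "insert f A"] assms(1)[OF that, of "A - {f}"] assms(2)[OF that, of f A]
    by (cases "f \<in> H t") (auto simp: gradient_def abs_le_iff)
  then have "\<bar>of_bool (e \<in> H t) * gradient f (\<phi> t) A\<bar> \<le> of_bool (e \<in> H t) * of_bool (f \<in> H t)"
    if "t \<in> J" for t
    using that by (cases "e \<in> H t") auto
  then show "\<bar>gradient f G A\<bar> \<le> joint_degree e f"
    unfolding G_def gradient_sum gradient_cmult joint_degree_def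
    by (intro order.trans[OF sum_abs] sum_mono)
qed

lemma gradient_T:
  "gradient e T = (\<lambda>A. \<Sum>t\<in>J. of_bool (e \<in> H t) * of_bool (H t - {e} \<subseteq> A))"
  unfolding gradient_def T_def sum_subtractf[symmetric]
  by (intro ext sum.cong) (auto simp: of_bool_def)

lemma gradient_T_bounds:
  "0 \<le> gradient e T A" "e \<in> S \<Longrightarrow> gradient e T A \<le> N"
  "\<bar>gradient f (gradient e T) A\<bar> \<le> joint_degree e f"
  unfolding gradient_T by (rule local_sum_bounds; auto)+

text \<open>The decompositions of the single indicators are added up. Here \<open>\<Phi> e\<close>
  is the resulting weight of the edge \<open>e\<close>, not the normal distribution
  function.\<close>

lemma centred_T_decomposition:
  obtains \<Phi> :: "'e \<Rightarrow> 'e set \<Rightarrow> real" where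
    "\<And>A. T A - expect T = (\<Sum>e\<in>S. (of_bool (e \<in> A) - p) * \<Phi> e A)"
    "\<And>e A. 0 \<le> \<Phi> e A" "\<And>e A. e \<in> S \<Longrightarrow> \<Phi> e A \<le> N"
    "\<And>e f A. \<bar>gradient f (\<Phi> e) A\<bar> \<le> joint_degree e f"
    "\<And>e A. \<Phi> e (insert e A) = \<Phi> e (A - {e})"
proof -
  define P where "P t \<phi> \<longleftrightarrow>
      (\<forall>A. (\<Sum>e\<in>H t. (of_bool (e \<in> A) - p) * \<phi> e A) = of_bool (H t \<subseteq> A) - p ^ card (H t)) \<and>
      (\<forall>e A. 0 \<le> \<phi> e A \<and> \<phi> e A \<le> 1) \<and>
      (\<forall>e f A. f = e \<or> f \<notin> H t \<longrightarrow> \<phi> e (insert f A) = \<phi> e (A - {f}))"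
    for t and \<phi> :: "'e \<Rightarrow> 'e set \<Rightarrow> real"
  have "\<exists>\<phi>. P t \<phi>" if "t \<in> J" for t
    unfolding P_def by (rule centred_indicator_decomposition[OF finite_H[OF that] p]) blast
  then obtain \<phi> where \<phi>: "\<And>t. t \<in> J \<Longrightarrow> P t (\<phi> t)" by metis
  define \<Phi> where "\<Phi> e A = (\<Sum>t\<in>J. of_bool (e \<in> H t) * \<phi> t e A)" for e A
  have inv: "\<Phi> e (insert e A) = \<Phi> e (A - {e})" for e A
    unfolding \<Phi>_def using \<phi> by (intro sum.cong) (auto simp: P_def)
  have dec: "T A - (\<Sum>t\<in>J. p ^ card (H t)) = (\<Sum>e\<in>S. (of_bool (e \<in> A) - p) * \<Phi> e A)" for A
  proof -
    have "(\<Sum>e\<in>S. (of_bool (e \<in> A) - p) * \<Phi> e A) =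
        (\<Sum>t\<in>J. \<Sum>e\<in>S. (of_bool (e \<in> A) - p) * (of_bool (e \<in> H t) * \<phi> t e A))"
      unfolding \<Phi>_def sum_distrib_left by (rule sum.swap)
    also have "\<dots> = (\<Sum>t\<in>J. of_bool (H t \<subseteq> A) - p ^ card (H t))"
    proof (rule sum.cong)
      fix t assume t: "t \<in> J"
      have "(\<Sum>e\<in>S. (of_bool (e \<in> A) - p) * (of_bool (e \<in> H t) * \<phi> t e A)) =
          (\<Sum>e\<in>H t. (of_bool (e \<in> A) - p) * \<phi> t e A)"
        using H[OF t] S by (intro sum.mono_neutral_cong_right) auto
      also have "\<dots> = of_bool (H t \<subseteq> A) - p ^ card (H t)"
        using \<phi>[OF t] unfolding P_def by blast
      finally show "(\<Sum>e\<in>S. (of_bool (e \<in> A) - p) * (of_bool (e \<in> H t) * \<phi> t e A)) =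
          of_bool (H t \<subseteq> A) - p ^ card (H t)" .
    qed simp
    finally show ?thesis by (simp add: T_def sum_subtractf)
  qed
  \<comment> \<open>Integration by parts against a constant; vanishing of all these means identifies
    \<open>expect T\<close>.\<close>
  have "expect (\<lambda>A. (of_bool (e \<in> A) - p) * \<Phi> e A) = 0" if "e \<in> S" for e
    using cube_integration_by_parts[OF p S that, where F = "\<Phi> e" and G = "\<lambda>_. 1"] inv
    by (simp add: gradient_def cube_expectation_const[OF S])
  then have "expect (\<lambda>A. T A - (\<Sum>t\<in>J. p ^ card (H t))) = 0"
    unfolding dec cube_expectation_sum by simp
  then have "expect T = (\<Sum>t\<in>J. p ^ card (H t))"
    unfolding cube_expectation_diff by (simp add: cube_expectation_const[OF S])
  moreover have "0 \<le> \<Phi> e A" "e \<in> S \<Longrightarrow> \<Phi> e A \<le> N" "\<bar>gradient f (\<Phi> e) A\<bar> \<le> joint_degree e f" for e f A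
    unfolding \<Phi>_def using \<phi> by (intro local_sum_bounds; auto simp: P_def)+
  ultimately show ?thesis
    using that[of \<Phi>] dec inv by simp
qed

theorem kolmogorov_bound:
  assumes pos: "0 < var_T"
  shows "\<bar>expect (\<lambda>A. of_bool ((T A - expect T) / sqrt var_T \<le> z)) - std_normal_cdf z\<bar>
    \<le> 4 * (1 + 2 * m) * sqrt (card S) * N\<^sup>2 / var_T"
proof -
  obtain \<Phi> :: "'e \<Rightarrow> 'e set \<Rightarrow> real" where
    dec: "\<And>A. T A - expect T = (\<Sum>e\<in>S. (of_bool (e \<in> A) - p) * \<Phi> e A)"
    and \<Phi>: "\<And>e A. 0 \<le> \<Phi> e A" "\<And>e A. e \<in> S \<Longrightarrow> \<Phi> e A \<le> N"
      "\<And>e f A. \<bar>gradient f (\<Phi> e) A\<bar> \<le> joint_degree e f"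
    and \<Phi>_inv: "\<And>e A. \<Phi> e (insert e A) = \<Phi> e (A - {e})"
    by (rule centred_T_decomposition) blast
  define a where "a e A = \<Phi> e A * gradient e T A" for e A
  define Q where "Q A = p * (1 - p) * (\<Sum>e\<in>S. a e A)" for A
  define U where "U A = (\<Sum>e\<in>S. (of_bool (e \<in> A) - p) * a e A)" for A
  \<comment> \<open>A common gradient bound for \<open>Q\<close> and \<open>U\<close>: the products
    \<open>a e\<close> contribute \<open>2 * m * N\<^sup>2\<close>, and the edge variable in front
    of them in \<open>U\<close> a further \<open>N\<^sup>2\<close>.\<close>
  define c where "c = (1 + 2 * m) * N\<^sup>2"
  have c: "0 \<le> c" using nonneg by (simp add: c_def)
  have pq: "0 \<le> p * (1 - p)" "p * (1 - p) \<le> 1"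
    using p by (simp_all add: mult_le_one)
  have ibp: "expect (\<lambda>A. (of_bool (e \<in> A) - p) * F A * G A) =
      p * (1 - p) * expect (\<lambda>A. F A * gradient e G A)"
    if "e \<in> S" "\<And>A. F (insert e A) = F (A - {e})" for e F G
    by (rule cube_integration_by_parts[OF p S that])
  have a_inv: "a e (insert e A) = a e (A - {e})" for e A
    by (simp add: a_def \<Phi>_inv gradient_def)
  have a_bounds: "0 \<le> a e A" "a e A \<le> N\<^sup>2" "\<bar>gradient f (a e) A\<bar> \<le> 2 * N * joint_degree e f"
    if e: "e \<in> S" for e f A
  proof -
    show "0 \<le> a e A" using \<Phi>(1) gradient_T_bounds(1) by (simp add: a_def)
    show "a e A \<le> N\<^sup>2"
      unfolding a_def power2_eq_square
      using \<Phi>(1,2) gradient_T_bounds(1,2) e nonneg by (intro mult_mono) auto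
    have "\<bar>gradient f (a e) A\<bar> \<le> joint_degree e f * N + N * joint_degree e f"
      unfolding a_def using \<Phi> gradient_T_bounds e
      by (intro gradient_mult_bound) (auto simp: abs_of_nonneg)
    then show "\<bar>gradient f (a e) A\<bar> \<le> 2 * N * joint_degree e f" by simp
  qed

  have sum_degree: "(\<Sum>e\<in>S. 2 * N * joint_degree e f) \<le> 2 * m * N\<^sup>2" if "f \<in> S" for f
  proof -
    have "2 * N * (\<Sum>e\<in>S. joint_degree e f) \<le> 2 * N * (m * N)"
      using sum_joint_degree[OF that] nonneg
      by (intro mult_left_mono) (auto simp: joint_degree_commute[of _ f])
    then show ?thesis by (simp add: sum_distrib_left power2_eq_square algebra_simps)
  qed

  have gradient_Q: "\<bar>gradient f Q A\<bar> \<le> c" if "f \<in> S" for f A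
  proof -
    have "\<bar>gradient f Q A\<bar> = p * (1 - p) * \<bar>\<Sum>e\<in>S. gradient f (a e) A\<bar>"
      using p unfolding Q_def gradient_cmult gradient_sum by (simp add: abs_mult)
    also have "\<dots> \<le> 1 * (\<Sum>e\<in>S. 2 * N * joint_degree e f)"
      using pq a_bounds(3) by (intro mult_mono order.trans[OF sum_abs] sum_mono) auto
    also have "\<dots> \<le> c"
      using sum_degree[OF that] zero_le_power2[of N] unfolding c_def distrib_right by linarith
    finally show ?thesis .
  qed

  have gradient_U: "\<bar>gradient f U A\<bar> \<le> c" if f: "f \<in> S" for f A
  proof -
    have "\<bar>gradient f (\<lambda>A. (of_bool (e \<in> A) - p) * a e A) A\<bar>
        \<le> of_bool (e = f) * N\<^sup>2 + 2 * N * joint_degree e f" if e: "e \<in> S" for e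
    proof (cases "e = f")
      case True
      \<comment> \<open>As \<open>a f\<close> ignores \<open>f\<close>, only the edge variable
        changes, and it changes by one.\<close>
      have "gradient f (\<lambda>A. (of_bool (f \<in> A) - p) * a f A) A = a f (A - {f})"
        by (simp add: gradient_def a_inv algebra_simps)
      moreover have "0 \<le> 2 * N * joint_degree f f"
        using nonneg joint_degree_nonneg by simp
      ultimately show ?thesis
        using True a_bounds(1,2)[OF f, of "A - {f}"] by simp
    next
      case False
      then have "gradient f (\<lambda>A. (of_bool (e \<in> A) - p) * a e A) A =
          (of_bool (e \<in> A) - p) * gradient f (a e) A"
        by (simp add: gradient_def algebra_simps)
      also have "\<bar>\<dots>\<bar> \<le> 1 * (2 * N * joint_degree e f)"
        unfolding abs_mult using p a_bounds(3)[OF e] by (intro mult_mono) auto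
      finally show ?thesis using False by simp
    qed
    then have "\<bar>gradient f U A\<bar> \<le> (\<Sum>e\<in>S. of_bool (e = f) * N\<^sup>2 + 2 * N * joint_degree e f)"
      unfolding U_def gradient_sum by (intro order.trans[OF sum_abs] sum_mono)
    also have "\<dots> = N\<^sup>2 + (\<Sum>e\<in>S. 2 * N * joint_degree e f)"
    proof -
      have "(\<Sum>e\<in>S. of_bool (e = f) * N\<^sup>2) = (\<Sum>e\<in>S. if e = f then N\<^sup>2 else 0)"
        by (intro sum.cong) auto
      then show ?thesis using S f by (simp add: sum.distrib)
    qed
    also have "\<dots> \<le> c"
      using sum_degree[OF f] unfolding c_def distrib_right by linarith
    finally show ?thesis .
  qed

  have gradient_centred: "gradient e (\<lambda>A. T A - expect T) A = gradient e T A" for e A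
    by (simp add: gradient_def)
  \<comment> \<open>One factor of the squared deviation is decomposed and integrated by parts
    against the other.\<close>
  have expect_Q: "expect Q = var_T"
  proof -
    have "var_T = expect (\<lambda>A. \<Sum>e\<in>S. (of_bool (e \<in> A) - p) * \<Phi> e A * (T A - expect T))"
      unfolding var_T_def power2_eq_square
      by (rule cube_expectation_cong, subst (1) dec) (simp add: sum_distrib_right)
    also have "\<dots> = (\<Sum>e\<in>S. p * (1 - p) * expect (a e))"
      unfolding cube_expectation_sum
      by (intro sum.cong) (simp_all add: ibp \<Phi>_inv gradient_centred a_def[abs_def])
    also have "\<dots> = expect Q"
      unfolding Q_def cube_expectation_cmult cube_expectation_sum sum_distrib_left ..
    finally show ?thesis ..
  qed

  have expect_U: "expect U = 0"
  proof -
    have "expect (\<lambda>A. (of_bool (e \<in> A) - p) * a e A * 1) = 0" if "e \<in> S" for e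
      by (subst ibp[OF that a_inv]) (simp add: gradient_def cube_expectation_const[OF S])
    then show ?thesis
      unfolding U_def cube_expectation_sum by simp
  qed

  have L1: "expect (\<lambda>A. \<bar>G A - expect G\<bar>) \<le> sqrt (card S) * c"
    if "\<And>f A. f \<in> S \<Longrightarrow> \<bar>gradient f G A\<bar> \<le> c" for G
  proof -
    have "expect (\<lambda>A. \<bar>G A - expect G\<bar>) \<le> sqrt (expect (\<lambda>A. (G A - expect G)\<^sup>2))"
      by (rule cube_expectation_abs_le_L2[OF p S])
    also have "\<dots> \<le> sqrt (card S * c\<^sup>2)"
      using cube_efron_stein[OF p S c that] by simp
    also have "\<dots> = sqrt (card S) * c"
      using c by (simp add: real_sqrt_mult)
    finally show ?thesis .
  qed

  define s where "s = sqrt var_T"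
  have s: "0 < s" "s * s = var_T" using pos by (simp_all add: s_def)
  define W where "W A = (T A - expect T) / s" for A
  define f where "f = stein_solution z"
  \<comment> \<open>\<open>g\<close> is the derivative of the Stein solution; the increments of the
    nondecreasing \<open>k\<close> control its linearisation error.\<close>
  define g where "g w = w * f w + of_bool (w \<le> z) - std_normal_cdf z" for w
  define k where "k w = w * f w - of_bool (w \<le> z)" for w
  have g2: "\<bar>g w\<bar> \<le> 2" and k2: "\<bar>k w\<bar> \<le> 2" for w
    using id_times_stein_solution_bounded[of w z] std_normal_cdf_nonneg[of z] std_normal_cdf_le_1[of z]
    by (auto simp: g_def k_def f_def abs_le_iff)

  have taylor: "\<bar>gradient e (\<lambda>A. f (W A)) A - gradient e T A / s * g (W A)\<bar>
      \<le> gradient e T A / s * gradient e (\<lambda>A. k (W A)) A" for e A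
  proof -
    have W: "W (insert e A) - W (A - {e}) = gradient e T A / s"
      by (simp add: W_def gradient_def diff_divide_distrib)
    \<comment> \<open>Nonnegativity of the gradient of \<open>T\<close> orders the two values of
      \<open>W\<close>, as \<open>stein_solution_taylor\<close> requires.\<close>
    have "W (A - {e}) \<le> W (insert e A)"
      using W gradient_T_bounds(1)[of e A] s(1) by (metis diff_ge_0_iff_ge divide_nonneg_pos)
    moreover have "W A = W (A - {e}) \<or> W A = W (insert e A)"
      by (cases "e \<in> A") (auto simp: insert_absorb)
    ultimately show ?thesis
      using stein_solution_taylor[of "W (A - {e})" "W (insert e A)" "W A" z]
      unfolding W by (simp add: gradient_def f_def g_def k_def)
  qed

  \<comment> \<open>Integrating by parts turns the first term into gradients of
    \<open>f (W A)\<close>; their linear parts add up to the term with \<open>Q\<close>, leaving the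
    Taylor remainder.\<close>
  have stein: "\<bar>expect (\<lambda>A. W A * f (W A)) - expect (\<lambda>A. Q A * g (W A)) / var_T\<bar>
      \<le> expect (\<lambda>A. U A * k (W A)) / var_T"
  proof -
    let ?d = "\<lambda>e A. gradient e (\<lambda>A. f (W A)) A - gradient e T A / s * g (W A)"
    have "expect (\<lambda>A. W A * f (W A)) =
        expect (\<lambda>A. (\<Sum>e\<in>S. (of_bool (e \<in> A) - p) * \<Phi> e A * f (W A)) / s)"
      by (rule cube_expectation_cong) (simp add: W_def dec sum_distrib_right sum_divide_distrib)
    also have "\<dots> = (\<Sum>e\<in>S. p * (1 - p) * expect (\<lambda>A. \<Phi> e A * gradient e (\<lambda>A. f (W A)) A)) / s"
      unfolding cube_expectation_divide cube_expectation_sum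
      by (intro arg_cong[of _ _ "\<lambda>x. x / s"] sum.cong ibp \<Phi>_inv) auto
    finally have 1: "expect (\<lambda>A. W A * f (W A)) =
        p * (1 - p) / s * (\<Sum>e\<in>S. expect (\<lambda>A. \<Phi> e A * gradient e (\<lambda>A. f (W A)) A))"
      by (simp add: sum_distrib_left sum_divide_distrib)
    have "expect (\<lambda>A. Q A * g (W A)) / var_T =
        expect (\<lambda>A. p * (1 - p) / s * (\<Sum>e\<in>S. \<Phi> e A * (gradient e T A / s * g (W A))))"
      unfolding cube_expectation_divide[symmetric] s(2)[symmetric] Q_def a_def
      by (rule cube_expectation_cong) (simp add: sum_distrib_left sum_distrib_right sum_divide_distrib mult_ac)
    then have 2: "expect (\<lambda>A. Q A * g (W A)) / var_T =
        p * (1 - p) / s * (\<Sum>e\<in>S. expect (\<lambda>A. \<Phi> e A * (gradient e T A / s * g (W A))))"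
      by (simp only: cube_expectation_cmult cube_expectation_sum)
    have "\<bar>expect (\<lambda>A. W A * f (W A)) - expect (\<lambda>A. Q A * g (W A)) / var_T\<bar> =
        p * (1 - p) / s * \<bar>\<Sum>e\<in>S. expect (\<lambda>A. \<Phi> e A * ?d e A)\<bar>"
      unfolding 1 2 right_diff_distrib[symmetric] sum_subtractf[symmetric] cube_expectation_diff[symmetric]
      using p s by (simp add: abs_mult)
    also have "\<dots> \<le> p * (1 - p) / s *
        (\<Sum>e\<in>S. expect (\<lambda>A. \<Phi> e A * (gradient e T A / s * gradient e (\<lambda>A. k (W A)) A)))"
    proof (intro mult_left_mono order.trans[OF sum_abs] sum_mono
        order.trans[OF cube_expectation_abs[OF p S]] cube_expectation_mono[OF p S])
      show "\<bar>\<Phi> e A * ?d e A\<bar> \<le> \<Phi> e A * (gradient e T A / s * gradient e (\<lambda>A. k (W A)) A)" for e A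
        using mult_left_mono[OF taylor[of e A] \<Phi>(1)[of e A]] \<Phi>(1)[of e A] by (simp only: abs_mult abs_of_nonneg)
    qed (use pq s in auto)
    also have "\<dots> = (\<Sum>e\<in>S. p * (1 - p) * expect (\<lambda>A. a e A * gradient e (\<lambda>A. k (W A)) A)) / var_T"
    proof -
      have "expect (\<lambda>A. \<Phi> e A * (gradient e T A / s * gradient e (\<lambda>A. k (W A)) A)) =
          expect (\<lambda>A. a e A * gradient e (\<lambda>A. k (W A)) A) / s" for e
        unfolding cube_expectation_divide[symmetric]
        by (rule cube_expectation_cong) (simp add: a_def)
      then show ?thesis
        by (simp add: s(2)[symmetric] sum_distrib_left sum_divide_distrib)
    qed
    \<comment> \<open>Integration by parts in reverse: the gradient of \<open>k (W A)\<close> is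
      removed rather than estimated, so that only the size of \<open>k\<close> matters.\<close>
    also have "(\<Sum>e\<in>S. p * (1 - p) * expect (\<lambda>A. a e A * gradient e (\<lambda>A. k (W A)) A)) =
        expect (\<lambda>A. U A * k (W A))"
      unfolding U_def sum_distrib_right cube_expectation_sum
      by (intro sum.cong) (auto simp: ibp a_inv)
    finally show ?thesis .
  qed

  have "expect (\<lambda>A. of_bool (W A \<le> z)) - std_normal_cdf z =
      expect (\<lambda>A. of_bool (W A \<le> z) - std_normal_cdf z)"
    by (simp add: cube_expectation_diff cube_expectation_const[OF S])
  also have "\<dots> = expect (\<lambda>A. g (W A)) - expect (\<lambda>A. W A * f (W A))"
    unfolding cube_expectation_diff[symmetric] by (rule cube_expectation_cong) (simp add: g_def)
  finally have "\<bar>expect (\<lambda>A. of_bool (W A \<le> z)) - std_normal_cdf z\<bar> \<le>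
      \<bar>expect (\<lambda>A. g (W A)) - expect (\<lambda>A. Q A * g (W A)) / var_T\<bar> + expect (\<lambda>A. U A * k (W A)) / var_T"
    using stein by linarith
  also have "expect (\<lambda>A. g (W A)) - expect (\<lambda>A. Q A * g (W A)) / var_T =
      expect (\<lambda>A. (var_T - Q A) * g (W A)) / var_T"
    using pos by (simp add: left_diff_distrib cube_expectation_diff cube_expectation_cmult diff_divide_distrib)
  \<comment> \<open>As \<open>Q\<close> has mean \<open>var_T\<close> and \<open>g\<close> is at
    most 2 in size, twice the mean absolute deviation of \<open>Q\<close> suffices; with the
    analogous bound for \<open>U\<close> this gives the factor 4.\<close>
  also have "\<bar>\<dots>\<bar> \<le> (2 * (sqrt (card S) * c)) / var_T"
  proof -
    have "\<bar>expect (\<lambda>A. (var_T - Q A) * g (W A))\<bar> \<le> expect (\<lambda>A. 2 * \<bar>Q A - expect Q\<bar>)"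
      using g2 unfolding expect_Q
      by (intro order.trans[OF cube_expectation_abs[OF p S]] cube_expectation_mono[OF p S])
        (auto simp: abs_mult mult.commute[of 2] abs_minus_commute intro!: mult_left_mono)
    also have "\<dots> \<le> 2 * (sqrt (card S) * c)"
      unfolding cube_expectation_cmult using L1[OF gradient_Q] by simp
    finally show ?thesis
      using pos by (simp add: divide_right_mono)
  qed
  also have "expect (\<lambda>A. U A * k (W A)) / var_T \<le> (2 * (sqrt (card S) * c)) / var_T"
  proof -
    have "expect (\<lambda>A. U A * k (W A)) \<le> expect (\<lambda>A. 2 * \<bar>U A - expect U\<bar>)"
    proof (rule cube_expectation_mono[OF p S])
      fix A
      have "U A * k (W A) \<le> \<bar>U A\<bar> * \<bar>k (W A)\<bar>"
        by (simp flip: abs_mult)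
      also have "\<dots> \<le> \<bar>U A\<bar> * 2"
        using k2 by (rule mult_left_mono) simp
      finally show "U A * k (W A) \<le> 2 * \<bar>U A - expect U\<bar>"
        by (simp add: expect_U)
    qed
    also have "\<dots> \<le> 2 * (sqrt (card S) * c)"
      unfolding cube_expectation_cmult using L1[OF gradient_U] by simp
    finally show ?thesis
      using pos by (simp add: divide_right_mono)
  qed
  finally show ?thesis
    by (simp add: W_def s_def c_def add_divide_distrib[symmetric] algebra_simps)
qed

text \<open>Cauchy-Schwarz against the centred number \<open>L\<close> of present edges: every
  \<open>t\<close> adds at least \<open>(1 - p) * p ^ l\<close> to the covariance of
  \<open>L\<close> and \<open>T\<close>.\<close>

lemma var_T_lower_bound:
  assumes "\<And>t. t \<in> J \<Longrightarrow> H t \<noteq> {}" "\<And>t. t \<in> J \<Longrightarrow> card (H t) \<le> l" "S \<noteq> {}"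
  shows "(1 - p) * p ^ (2 * l) * (real (card J))\<^sup>2 / card S \<le> var_T"
proof -
  define L where "L A = (\<Sum>e\<in>S. of_bool (e \<in> A) - p)" for A
  have edge: "expect (\<lambda>A. (of_bool (e \<in> A) - p) * G A) = p * (1 - p) * expect (gradient e G)"
    if "e \<in> S" for e G
    using cube_integration_by_parts[OF p S that, where F = "\<lambda>_. 1" and G = G] by simp
  have cov: "expect (\<lambda>A. L A * G A) = (\<Sum>e\<in>S. p * (1 - p) * expect (gradient e G))" for G
    unfolding L_def sum_distrib_right cube_expectation_sum by (intro sum.cong) (auto simp: edge)
  \<comment> \<open>All terms of the centred indicator's decomposition have mean zero.\<close>
  have sub: "expect (\<lambda>A. of_bool (B \<subseteq> A)) = p ^ card B" if "B \<subseteq> S" for B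
  proof -
    have "finite B" using that S finite_subset by blast
    obtain \<phi> where dec: "\<And>A. (\<Sum>e\<in>B. (of_bool (e \<in> A) - p) * \<phi> e A) = of_bool (B \<subseteq> A) - p ^ card B"
      and inv: "\<And>e f A. f = e \<or> f \<notin> B \<Longrightarrow> \<phi> e (insert f A) = \<phi> e (A - {f})"
      by (rule centred_indicator_decomposition[OF \<open>finite B\<close> p]) blast
    have "expect (\<lambda>A. (of_bool (e \<in> A) - p) * \<phi> e A) = 0" if "e \<in> B" for e
      using inv \<open>B \<subseteq> S\<close> that edge[of e "\<phi> e"]
      by (auto simp: gradient_def[abs_def] cube_expectation_const[OF S])
    then have "expect (\<lambda>A. of_bool (B \<subseteq> A) - p ^ card B) = 0"
      unfolding dec[symmetric] cube_expectation_sum by simp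
    then show ?thesis by (simp add: cube_expectation_diff cube_expectation_const[OF S])
  qed
  have L2: "expect (\<lambda>A. (L A)\<^sup>2) = card S * (p * (1 - p))"
  proof -
    have "gradient e L A = 1" if "e \<in> S" for e A
    proof -
      have "gradient e L A = (\<Sum>f\<in>S. of_bool (f = e))"
        unfolding L_def gradient_sum by (intro sum.cong) (auto simp: gradient_def)
      also have "\<dots> = 1" using that S by (simp add: of_bool_def)
      finally show ?thesis .
    qed
    then show ?thesis
      unfolding power2_eq_square cov by (simp add: cube_expectation_const[OF S] cong: cube_expectation_cong)
  qed
  have LT: "(1 - p) * p ^ l * card J \<le> expect (\<lambda>A. L A * (T A - expect T))"
  proof -
    have one: "(1 - p) * p ^ l \<le> p * (1 - p) * (\<Sum>e\<in>H t. expect (\<lambda>A. of_bool (H t - {e} \<subseteq> A)))"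
      if t: "t \<in> J" for t
    proof -
      have "(1 - p) * p ^ l \<le> (1 - p) * p ^ card (H t)"
        using p assms(2)[OF t] by (intro mult_left_mono power_decreasing) auto
      also have "\<dots> \<le> card (H t) * ((1 - p) * p ^ card (H t))"
      proof -
        have "1 \<le> card (H t)"
          using assms(1)[OF t] finite_H[OF t] by (simp add: Suc_le_eq card_gt_0_iff)
        then show ?thesis
          using mult_right_mono[of 1 "real (card (H t))" "(1 - p) * p ^ card (H t)"] p by simp
      qed
      also have "\<dots> = (\<Sum>e\<in>H t. (1 - p) * p ^ card (H t))" by simp
      also have "\<dots> = (\<Sum>e\<in>H t. p * (1 - p) * expect (\<lambda>A. of_bool (H t - {e} \<subseteq> A)))"
      proof (rule sum.cong)
        fix e assume e: "e \<in> H t"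
        then have "card (H t) = Suc (card (H t - {e}))"
          using finite_H[OF t] card_Suc_Diff1 by metis
        moreover have "H t - {e} \<subseteq> S" using H[OF t] by blast
        ultimately show "(1 - p) * p ^ card (H t) = p * (1 - p) * expect (\<lambda>A. of_bool (H t - {e} \<subseteq> A))"
          using sub[of "H t - {e}"] by simp
      qed simp
      finally show ?thesis by (simp add: sum_distrib_left)
    qed
    have "(1 - p) * p ^ l * card J = (\<Sum>t\<in>J. (1 - p) * p ^ l)" by simp
    also have "\<dots> \<le> (\<Sum>t\<in>J. p * (1 - p) * (\<Sum>e\<in>H t. expect (\<lambda>A. of_bool (H t - {e} \<subseteq> A))))"
      using one by (rule sum_mono)
    also have "\<dots> = (\<Sum>t\<in>J. p * (1 - p) * (\<Sum>e\<in>S. of_bool (e \<in> H t) * expect (\<lambda>A. of_bool (H t - {e} \<subseteq> A))))"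
      using H S by (intro sum.cong arg_cong[of _ _ "(*) _"] sum.mono_neutral_cong_left) auto
    also have "\<dots> = p * (1 - p) * (\<Sum>e\<in>S. \<Sum>t\<in>J. of_bool (e \<in> H t) * expect (\<lambda>A. of_bool (H t - {e} \<subseteq> A)))"
      unfolding sum_distrib_left[symmetric] by (subst sum.swap) simp
    also have "\<dots> = (\<Sum>e\<in>S. p * (1 - p) * expect (gradient e T))"
      unfolding gradient_T cube_expectation_sum cube_expectation_cmult sum_distrib_left ..
    also have "\<dots> = expect (\<lambda>A. L A * (T A - expect T))"
      unfolding cov by (simp add: gradient_def[abs_def])
    finally show ?thesis .
  qed
  have "((1 - p) * p ^ l * card J)\<^sup>2 \<le> (expect (\<lambda>A. L A * (T A - expect T)))\<^sup>2"
    using LT p by (intro power_mono) auto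
  also have "\<dots> \<le> card S * (p * (1 - p)) * var_T"
    unfolding L2[symmetric] var_T_def by (rule cube_expectation_cauchy_schwarz[OF p S])
  finally have *: "((1 - p) * p ^ l * card J)\<^sup>2 \<le> card S * (p * (1 - p)) * var_T" .
  have "0 < card S" using S assms(3) by (simp add: card_gt_0_iff)
  have "0 \<le> var_T"
    unfolding var_T_def using cube_expectation_mono[OF p S, of "\<lambda>_. 0"]
    by (simp add: cube_expectation_const[OF S])
  \<comment> \<open>One factor \<open>1 - p\<close> is set aside to cancel against the variance of
    \<open>L\<close>, whose factor \<open>p\<close> is bounded by 1.\<close>
  have "(1 - p) * ((1 - p) * p ^ (2 * l) * (real (card J))\<^sup>2) = ((1 - p) * p ^ l * card J)\<^sup>2"
    by (simp add: power_mult_distrib power_even_eq) (simp add: power2_eq_square)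
  also note *
  also have "card S * (p * (1 - p)) * var_T \<le> (1 - p) * (card S * var_T)"
    using mult_right_mono[of p 1 "(1 - p) * (card S * var_T)"] p \<open>0 \<le> var_T\<close>
    by (simp add: mult_ac)
  finally have "(1 - p) * p ^ (2 * l) * (real (card J))\<^sup>2 \<le> card S * var_T"
    using p by simp
  then show ?thesis
    using \<open>0 < card S\<close> by (simp add: divide_le_eq mult.commute)
qed

end

subsection \<open>Subgraph counts\<close>

text \<open>The space splits into the finitely many events \<open>B A\<close> on which the random
  set equals \<open>A\<close>; independence gives each its product weight.\<close>

lemma (in prob_space) bernoulli_set:
  fixes Y :: "'e \<Rightarrow> 'a \<Rightarrow> bool" and G :: "'e set \<Rightarrow> real"
  assumes S: "finite S" and p: "0 < p" "p < 1"
    and indep: "indep_vars (\<lambda>_. count_space UNIV) Y S"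
    and distr: "\<And>e. e \<in> S \<Longrightarrow> distr M (count_space UNIV) (Y e) = measure_pmf (bernoulli_pmf p)"
  shows expectation_bernoulli_set: "expectation (\<lambda>\<omega>. G {e \<in> S. Y e \<omega>}) = cube_expectation p S G"
    and prob_bernoulli_set: "prob {\<omega> \<in> space M. P {e \<in> S. Y e \<omega>}} = cube_expectation p S (\<lambda>A. of_bool (P A))"
proof -
  define X where "X \<omega> = {e \<in> S. Y e \<omega>}" for \<omega>
  define B where "B A = {\<omega> \<in> space M. X \<omega> = A}" for A
  have rv: "Y e \<in> measurable M (count_space UNIV)" if "e \<in> S" for e
    using indep that by (auto simp: indep_vars_def2)
  have single: "prob (Y e -` {b} \<inter> space M) = (if b then p else 1 - p)" if "e \<in> S" for e b
  proof -
    have "prob (Y e -` {b} \<inter> space M) = measure (distr M (count_space UNIV) (Y e)) {b}"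
      using rv[OF that] by (simp add: measure_distr)
    also have "\<dots> = pmf (bernoulli_pmf p) b"
      unfolding distr[OF that] by (simp add: measure_pmf_single)
    finally show ?thesis using p by simp
  qed
  have B_eq: "B A = {\<omega> \<in> space M. \<forall>e\<in>S. Y e \<omega> = (e \<in> A)}" if "A \<subseteq> S" for A
    using that by (auto simp: B_def X_def)
  have B_sets: "B A \<in> sets M" if "A \<subseteq> S" for A
    unfolding B_eq[OF that]
  proof (intro sets.sets_Collect_finite_All S)
    fix e assume "e \<in> S"
    have "Y e -` {e \<in> A} \<inter> space M \<in> sets M"
      using measurable_sets[OF rv[OF \<open>e \<in> S\<close>]] by simp
    also have "Y e -` {e \<in> A} \<inter> space M = {\<omega> \<in> space M. Y e \<omega> = (e \<in> A)}" by auto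
    finally show "{\<omega> \<in> space M. Y e \<omega> = (e \<in> A)} \<in> sets M" .
  qed
  have prob_B: "prob (B A) = p ^ card A * (1 - p) ^ card (S - A)" if A: "A \<subseteq> S" for A
  proof (cases "S = {}")
    \<comment> \<open>The product rule for independent events needs a nonempty index set.\<close>
    case True
    then show ?thesis using A by (simp add: B_eq prob_space)
  next
    case False
    have "B A = (\<Inter>e\<in>S. Y e -` {e \<in> A} \<inter> space M)"
      unfolding B_eq[OF A] using False by auto
    also have "prob \<dots> = (\<Prod>e\<in>S. prob (Y e -` {e \<in> A} \<inter> space M))"
      using indep False S by (intro indep_varsD) auto
    also have "\<dots> = (\<Prod>e\<in>S. if e \<in> A then p else 1 - p)"
      by (intro prod.cong) (simp_all add: single)
    also have "\<dots> = p ^ card (S \<inter> A) * (1 - p) ^ card (S - A)"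
      using S by (simp add: prod.If_cases Diff_eq)
    finally show ?thesis using A by (simp add: Int_absorb1)
  qed
  have expect: "expectation (\<lambda>\<omega>. G (X \<omega>)) = cube_expectation p S G" for G
  proof -
    have "expectation (\<lambda>\<omega>. G (X \<omega>)) = expectation (\<lambda>\<omega>. \<Sum>A\<in>Pow S. G A * indicator (B A) \<omega>)"
    proof (rule Bochner_Integration.integral_cong)
      fix \<omega> assume "\<omega> \<in> space M"
      then have "(\<Sum>A\<in>Pow S. G A * indicator (B A) \<omega>) = (\<Sum>A\<in>Pow S. if A = X \<omega> then G A else 0)"
        by (intro sum.cong) (auto simp: B_def)
      also have "\<dots> = G (X \<omega>)"
        using S by (subst sum.delta) (auto simp: X_def)
      finally show "G (X \<omega>) = (\<Sum>A\<in>Pow S. G A * indicator (B A) \<omega>)" ..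
    qed simp
    also have "\<dots> = (\<Sum>A\<in>Pow S. expectation (\<lambda>\<omega>. G A * indicator (B A) \<omega>))"
      using B_sets by (intro Bochner_Integration.integral_sum) (auto simp: emeasure_eq_measure)
    also have "\<dots> = cube_expectation p S G"
      unfolding cube_expectation_def using B_sets prob_B
      by (intro sum.cong) (auto simp: Int_absorb2 sets.sets_into_space)
    finally show ?thesis .
  qed
  then show "expectation (\<lambda>\<omega>. G {e \<in> S. Y e \<omega>}) = cube_expectation p S G"
    by (simp add: X_def)
  have "{\<omega> \<in> space M. P (X \<omega>)} = (\<Union>A\<in>{A \<in> Pow S. P A}. B A)"
    by (auto simp: B_def X_def)
  also have "\<dots> \<in> sets M"
    using S B_sets by (intro sets.finite_UN) auto
  finally have "prob {\<omega> \<in> space M. P (X \<omega>)} = expectation (indicator {\<omega> \<in> space M. P (X \<omega>)})"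
    by simp
  also have "\<dots> = expectation (\<lambda>\<omega>. of_bool (P (X \<omega>)))"
    by (intro Bochner_Integration.integral_cong) (auto simp: indicator_def)
  also have "\<dots> = cube_expectation p S (\<lambda>A. of_bool (P A))"
    by (rule expect)
  finally show "prob {\<omega> \<in> space M. P {e \<in> S. Y e \<omega>}} = cube_expectation p S (\<lambda>A. of_bool (P A))"
    by (simp add: X_def)
qed

section \<open>Counting placements of copies\<close>

definition node_pairs :: "nat \<Rightarrow> (nat \<times> nat) set" where
  "node_pairs n = {(i, j). 1 \<le> i \<and> i < j \<and> j \<le> n}"

definition edge_pairs :: "nat set set \<Rightarrow> (nat \<times> nat) set" where
  "edge_pairs D = {(i, j). i < j \<and> {i, j} \<in> D}"

definition placed_edges :: "(nat \<Rightarrow> nat) \<times> nat set set \<Rightarrow> (nat \<times> nat) set" where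
  "placed_edges = (\<lambda>(\<alpha>, D). (\<lambda>(i, j). (\<alpha> i, \<alpha> j)) ` edge_pairs D)"

lemma node_pairs_subset: "node_pairs n \<subseteq> {1..n} \<times> {1..n}"
  by (auto simp: node_pairs_def)

lemma finite_node_pairs: "finite (node_pairs n)"
  by (rule finite_subset[OF node_pairs_subset]) simp

lemma card_node_pairs_le: "card (node_pairs n) \<le> n\<^sup>2"
  using card_mono[OF _ node_pairs_subset, of n] by (simp add: power2_eq_square)

lemma edge_pairs_subset:
  assumes "D \<in> copies V E"
  shows "edge_pairs D \<subseteq> node_pairs (card V)"
  using assms by (auto simp: copies_def simple_graph_def edge_pairs_def node_pairs_def)

lemma finite_edge_pairs: "D \<in> copies V E \<Longrightarrow> finite (edge_pairs D)"
  using edge_pairs_subset finite_node_pairs finite_subset by metis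

lemma finite_increasing_tuples: "finite (increasing_tuples k n)"
  unfolding increasing_tuples_def by (rule finite_subset[of _ "{1..k} \<rightarrow>\<^sub>E {1..n}"]) (auto intro: finite_PiE)

lemma finite_copies: "finite (copies V E)"
  by (rule finite_subset[of _ "Pow (Pow {1..card V})"]) (auto simp: copies_def simple_graph_def)

text \<open>A strictly increasing tuple keeps the smaller endpoint first, so placed edges are again
  ordered pairs.\<close>

lemma placed_edges_subset:
  assumes "\<alpha> \<in> increasing_tuples (card V) n" "D \<in> copies V E"
  shows "placed_edges (\<alpha>, D) \<subseteq> node_pairs n"
proof -
  have "(\<alpha> i, \<alpha> j) \<in> node_pairs n" if "(i, j) \<in> edge_pairs D" for i j
  proof -
    have ij: "i \<in> {1..card V}" "j \<in> {1..card V}" "i < j"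
      using edge_pairs_subset[OF assms(2)] that by (auto simp: node_pairs_def)
    then have "\<alpha> i < \<alpha> j" "\<alpha> i \<in> {1..n}" "\<alpha> j \<in> {1..n}"
      using assms(1) by (auto simp: increasing_tuples_def strict_mono_on_def)
    then show ?thesis by (simp add: node_pairs_def)
  qed
  then show ?thesis by (auto simp: placed_edges_def)
qed

lemma card_placed_edges_le:
  assumes "D \<in> copies V E"
  shows "card (placed_edges (\<alpha>, D)) \<le> (card V)\<^sup>2"
proof -
  have "card (placed_edges (\<alpha>, D)) \<le> card (edge_pairs D)"
    unfolding placed_edges_def using card_image_le[OF finite_edge_pairs[OF assms]] by simp
  also have "\<dots> \<le> card (node_pairs (card V))"
    by (rule card_mono[OF finite_node_pairs edge_pairs_subset[OF assms]])
  also note card_node_pairs_le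
  finally show ?thesis .
qed

text \<open>An edge of \<open>E\<close> is pulled back along the isomorphism; the variance bound
  needs every placement to use some edge.\<close>

lemma placed_edges_nonempty:
  assumes "simple_graph V E" "E \<noteq> {}" "D \<in> copies V E"
  shows "placed_edges (\<alpha>, D) \<noteq> {}"
proof -
  obtain f where f: "bij_betw f {1..card V} V"
    "\<And>u v. u \<in> {1..card V} \<Longrightarrow> v \<in> {1..card V} \<Longrightarrow> {u, v} \<in> D \<longleftrightarrow> {f u, f v} \<in> E"
    using assms(3) unfolding copies_def graph_isomorphic_def by blast
  obtain e where e: "e \<in> E" "e \<subseteq> V" "card e = 2"
    using assms(1,2) unfolding simple_graph_def by blast
  then obtain x y where xy: "e = {x, y}" "x \<noteq> y"
    by (auto simp: card_2_iff)
  have "x \<in> f ` {1..card V}" "y \<in> f ` {1..card V}"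
    using e(2) xy(1) bij_betw_imp_surj_on[OF f(1)] by auto
  then obtain u v where uv: "u \<in> {1..card V}" "v \<in> {1..card V}" "f u = x" "f v = y"
    by blast
  then have "{u, v} \<in> D" "u \<noteq> v"
    using f(2)[of u v] e(1) xy by auto
  then have "(min u v, max u v) \<in> edge_pairs D"
    by (cases "u < v") (auto simp: edge_pairs_def insert_commute)
  then show ?thesis by (auto simp: placed_edges_def)
qed

text \<open>Pulling \<open>E\<close> back along any enumeration of \<open>V\<close> yields a
  copy.\<close>

lemma copies_nonempty:
  assumes "simple_graph V E"
  shows "copies V E \<noteq> {}"
proof -
  have V: "finite V" and E: "\<And>e. e \<in> E \<Longrightarrow> e \<subseteq> V \<and> card e = 2"
    using assms by (auto simp: simple_graph_def)
  obtain f where f: "bij_betw f {1..card V} V"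
    using ex_bij_betw_nat_finite_1[OF V] by blast
  define D where "D = {{u, v} | u v. u \<in> {1..card V} \<and> v \<in> {1..card V} \<and> {f u, f v} \<in> E}"
  have "graph_isomorphic {1..card V} D V E"
    unfolding graph_isomorphic_def
    by (intro exI[of _ f] conjI f ballI) (auto simp: D_def doubleton_eq_iff insert_commute)
  moreover have "simple_graph {1..card V} D"
  proof -
    have "e \<subseteq> {1..card V} \<and> card e = 2" if "e \<in> D" for e
    proof -
      obtain u v where uv: "e = {u, v}" "u \<in> {1..card V}" "v \<in> {1..card V}" "{f u, f v} \<in> E"
        using \<open>e \<in> D\<close> unfolding D_def by blast
      then have "u \<noteq> v" using E[of "{f u, f v}"] by auto
      with uv show ?thesis by auto
    qed
    then show ?thesis by (auto simp: simple_graph_def)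
  qed
  ultimately show ?thesis by (auto simp: copies_def)
qed

lemma card_ge_2:
  assumes "simple_graph V E" "E \<noteq> {}"
  shows "2 \<le> card V"
  using assms card_mono unfolding simple_graph_def by (metis ex_in_conv)

lemma card_tuples_through_two_points:
  assumes "i \<in> {1..k}" "j \<in> {1..k}" "i \<noteq> j"
  shows "card {\<alpha> \<in> {1..k} \<rightarrow>\<^sub>E {1..n}. \<alpha> i = u \<and> \<alpha> j = v} \<le> n ^ (k - 2)"
proof -
  define B where "B l = (if l \<in> {i, j} then {if l = i then u else v} else {1..n})" for l
  have "card {\<alpha> \<in> {1..k} \<rightarrow>\<^sub>E {1..n}. \<alpha> i = u \<and> \<alpha> j = v} \<le> card (PiE {1..k} B)"
    by (intro card_mono finite_PiE) (auto simp: B_def PiE_iff extensional_def)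
  also have "\<dots> = (\<Prod>l\<in>{1..k}. if l \<in> {i, j} then 1 else n)"
    unfolding card_PiE[OF finite_atLeastAtMost] by (intro prod.cong) (auto simp: B_def)
  also have "\<dots> = n ^ card ({1..k} - {i, j})"
    by (subst prod.If_cases) (auto simp: Diff_eq Compl_eq)
  also have "card ({1..k} - {i, j}) = k - 2"
    using assms by (simp add: card_Diff_subset)
  finally show ?thesis .
qed

text \<open>Some pair of nodes of the copy must land on \<open>e\<close>. There are at most
  \<open>(card V)\<^sup>2\<close> such pairs, and each fixes two coordinates of the tuple;
  monotonicity of the tuple is dropped for the upper bound.\<close>

lemma card_placements_through_edge:
  "card {t \<in> increasing_tuples (card V) n \<times> copies V E. e \<in> placed_edges t}
    \<le> (card V)\<^sup>2 * card (copies V E) * n ^ (card V - 2)"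
proof -
  let ?k = "card V"
  obtain u v where e: "e = (u, v)" by fastforce
  define R where "R = (\<lambda>(i, j). {\<alpha> \<in> {1..?k} \<rightarrow>\<^sub>E {1..n}. \<alpha> i = u \<and> \<alpha> j = v} \<times> copies V E)"
  have fin: "finite (R x)" for x
    by (auto simp: R_def case_prod_beta intro!: finite_cartesian_product finite_copies finite_PiE
        finite_subset[of "{\<alpha> \<in> _. _ \<alpha>}" "{1..?k} \<rightarrow>\<^sub>E {1..n}"])
  have "{t \<in> increasing_tuples ?k n \<times> copies V E. e \<in> placed_edges t} \<subseteq> (\<Union>x\<in>node_pairs ?k. R x)"
  proof
    fix t assume t: "t \<in> {t \<in> increasing_tuples ?k n \<times> copies V E. e \<in> placed_edges t}"
    then obtain \<alpha> D where \<alpha>D: "t = (\<alpha>, D)" "\<alpha> \<in> increasing_tuples ?k n" "D \<in> copies V E"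
      by auto
    with t obtain i j where "(i, j) \<in> edge_pairs D" "\<alpha> i = u" "\<alpha> j = v"
      by (auto simp: placed_edges_def e)
    with \<alpha>D edge_pairs_subset show "t \<in> (\<Union>x\<in>node_pairs ?k. R x)"
      by (intro UN_I[of "(i, j)"]) (auto simp: R_def increasing_tuples_def)
  qed
  then have "card {t \<in> increasing_tuples ?k n \<times> copies V E. e \<in> placed_edges t}
      \<le> card (\<Union>x\<in>node_pairs ?k. R x)"
    by (rule card_mono[rotated]) (use finite_node_pairs fin in auto)
  also have "\<dots> \<le> (\<Sum>x\<in>node_pairs ?k. card (R x))"
    by (rule card_UN_le[OF finite_node_pairs])
  also have "\<dots> \<le> (\<Sum>x\<in>node_pairs ?k. n ^ (?k - 2) * card (copies V E))"
  proof (rule sum_mono)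
    fix x assume "x \<in> node_pairs ?k"
    then obtain i j where "x = (i, j)" "i \<in> {1..?k}" "j \<in> {1..?k}" "i \<noteq> j"
      by (auto simp: node_pairs_def)
    then show "card (R x) \<le> n ^ (?k - 2) * card (copies V E)"
      using card_tuples_through_two_points[of i ?k j n u v] by (simp add: R_def card_cartesian_product)
  qed
  also have "\<dots> \<le> ?k\<^sup>2 * (n ^ (?k - 2) * card (copies V E))"
    using card_node_pairs_le by (simp add: mult_right_mono)
  finally show ?thesis by (simp add: mult_ac)
qed

text \<open>The tuples with \<open>\<alpha>(i)\<close> in the \<open>i\<close>-th of \<open>k\<close> consecutive blocks are increasing.\<close>

lemma card_increasing_tuples_ge: "(n div k) ^ k \<le> card (increasing_tuples k n)"
proof -
  define b where "b = n div k"
  have bk: "k * b \<le> n" by (simp add: b_def)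
  have "PiE {1..k} (\<lambda>i. {(i - 1) * b + 1..i * b}) \<subseteq> increasing_tuples k n"
  proof
    fix \<alpha> assume \<alpha>: "\<alpha> \<in> PiE {1..k} (\<lambda>i. {(i - 1) * b + 1..i * b})"
    have le: "\<alpha> i \<in> {(i - 1) * b + 1..i * b}" if "i \<in> {1..k}" for i
      using \<alpha> that by (rule PiE_mem)
    have "\<alpha> i \<in> {1..n}" if "i \<in> {1..k}" for i
    proof -
      have "i * b \<le> k * b" using that by simp
      then show ?thesis
        using le[OF that] bk unfolding atLeastAtMost_iff by linarith
    qed
    moreover have "\<alpha> i < \<alpha> j" if "i \<in> {1..k}" "j \<in> {1..k}" "i < j" for i j
    proof -
      \<comment> \<open>Block \<open>i\<close> ends at \<open>i * b\<close>, and block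
        \<open>j\<close> starts one beyond \<open>(j - 1) * b\<close>, which gives
        strictness.\<close>
      have "i * b \<le> (j - 1) * b" using that by (intro mult_right_mono) auto
      then show ?thesis
        using le[OF that(1)] le[OF that(2)] unfolding atLeastAtMost_iff by linarith
    qed
    ultimately show "\<alpha> \<in> increasing_tuples k n"
      using \<alpha> by (auto simp: increasing_tuples_def strict_mono_on_def PiE_iff)
  qed
  then have "card (PiE {1..k} (\<lambda>i. {(i - 1) * b + 1..i * b})) \<le> card (increasing_tuples k n)"
    by (rule card_mono[OF finite_increasing_tuples])
  moreover have "card (PiE {1..k} (\<lambda>i. {(i - 1) * b + 1..i * b})) = (\<Prod>i\<in>{1..k}. b)"
    unfolding card_PiE[OF finite_atLeastAtMost]
  proof (rule prod.cong)
    fix i assume "i \<in> {1..k}"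
    then show "card {(i - 1) * b + 1..i * b} = b" by (cases i) auto
  qed simp
  ultimately show ?thesis
    by (simp add: b_def)
qed

section \<open>From subgraph counts to the discrete cube\<close>

lemma prod_of_bool:
  "finite A \<Longrightarrow> (\<Prod>x\<in>A. of_bool (P x) :: real) = of_bool (\<forall>x\<in>A. P x)"
  by (induction rule: finite_induct) auto

lemma inj_subgraph_count_eq:
  "inj_subgraph_count V E n \<xi> \<omega> =
    (\<Sum>t\<in>increasing_tuples (card V) n \<times> copies V E.
      of_bool (placed_edges t \<subseteq> {e \<in> node_pairs n. case e of (i, j) \<Rightarrow> \<xi> i j \<omega>}))"
proof -
  have "(\<Prod>(i, j)\<in>edge_pairs D. of_bool (\<xi> (\<alpha> i) (\<alpha> j) \<omega>) :: real) =
      of_bool (placed_edges (\<alpha>, D) \<subseteq> {e \<in> node_pairs n. case e of (i, j) \<Rightarrow> \<xi> i j \<omega>})"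
    if "\<alpha> \<in> increasing_tuples (card V) n" "D \<in> copies V E" for \<alpha> D
  proof -
    have "(\<Prod>(i, j)\<in>edge_pairs D. of_bool (\<xi> (\<alpha> i) (\<alpha> j) \<omega>) :: real) =
        of_bool (\<forall>(i, j)\<in>edge_pairs D. \<xi> (\<alpha> i) (\<alpha> j) \<omega>)"
      using prod_of_bool[OF finite_edge_pairs[OF that(2)], of "\<lambda>(i, j). \<xi> (\<alpha> i) (\<alpha> j) \<omega>"]
      by (simp add: case_prod_beta)
    also have "(\<forall>(i, j)\<in>edge_pairs D. \<xi> (\<alpha> i) (\<alpha> j) \<omega>) \<longleftrightarrow>
        placed_edges (\<alpha>, D) \<subseteq> {e \<in> node_pairs n. case e of (i, j) \<Rightarrow> \<xi> i j \<omega>}"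
      using placed_edges_subset[OF that] by (auto simp: placed_edges_def)
    finally show ?thesis .
  qed
  then show ?thesis
    unfolding inj_subgraph_count_def edge_pairs_def[symmetric] sum.cartesian_product
    by (intro sum.cong) auto
qed

text \<open>Here N = \<open>c\<close> n^(k-2), the root of the number of node pairs is at most n,
  and the variance is at least \<open>d\<close> n^(2k-2), so the quotient is of order 1/n. In
  \<open>d\<close>, \<open>p ^ (2 * k\<^sup>2)\<close> comes from the at most
  \<open>k\<^sup>2\<close> edges and the denominator from squaring (n/(2k))^k.\<close>

lemma inj_subgraph_count_kolmogorov:
  fixes V :: "'v set" and E :: "'v set set" and n :: nat and p :: real
  defines "k \<equiv> card V"
  defines "c \<equiv> real (k\<^sup>2 * card (copies V E))"
    and "d \<equiv> (1 - p) * p ^ (2 * k\<^sup>2) / (2 * real k) ^ (2 * k)"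
  assumes graph: "simple_graph V E" "E \<noteq> {}" and p: "0 < p" "p < 1"
    and ER: "erdos_renyi n p M \<xi>" and nk: "k \<le> n"
  shows "\<bar>measure M {\<omega> \<in> space M. standardized M (inj_subgraph_count V E n \<xi>) \<omega> \<le> z} - std_normal_cdf z\<bar>
    \<le> 4 * (1 + 2 * real (k\<^sup>2)) * c\<^sup>2 / d / n"
proof -
  have M: "prob_space M" and indep: "prob_space.indep_vars M (\<lambda>_. count_space UNIV) (\<lambda>(i, j). \<xi> i j) (node_pairs n)"
    and distr: "\<And>e. e \<in> node_pairs n \<Longrightarrow>
      distr M (count_space UNIV) (case e of (i, j) \<Rightarrow> \<xi> i j) = measure_pmf (bernoulli_pmf p)"
    using ER by (auto simp: erdos_renyi_def node_pairs_def)
  interpret prob_space M by (rule M)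
  define J where "J = increasing_tuples k n \<times> copies V E"
  define X where "X \<omega> = {e \<in> node_pairs n. (case e of (i, j) \<Rightarrow> \<xi> i j) \<omega>}" for \<omega>
  have k2: "2 \<le> k" unfolding k_def by (rule card_ge_2[OF graph])
  have n0: "0 < real n" using k2 nk by simp
  interpret C: cube_indicator_sum p "node_pairs n" J placed_edges "real (k\<^sup>2)" "c * real n ^ (k - 2)"
  proof
    show "real (card {t \<in> J. e \<in> placed_edges t}) \<le> c * real n ^ (k - 2)" for e
      using card_placements_through_edge[of V n E e]
      unfolding c_def J_def k_def of_nat_power[symmetric] of_nat_mult[symmetric] of_nat_le_iff .
    show "real (card (placed_edges t)) \<le> real (k\<^sup>2)" if "t \<in> J" for t
      using that card_placed_edges_le unfolding J_def k_def of_nat_le_iff by auto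
    show "finite J"
      unfolding J_def by (intro finite_cartesian_product finite_increasing_tuples finite_copies)
    show "placed_edges t \<subseteq> node_pairs n" if "t \<in> J" for t
      using that placed_edges_subset unfolding J_def k_def by blast
  qed (use p finite_node_pairs in \<open>simp_all add: c_def\<close>)

  note law = finite_node_pairs p indep distr
  have T: "inj_subgraph_count V E n \<xi> = (\<lambda>\<omega>. C.T (X \<omega>))"
    by (simp add: fun_eq_iff inj_subgraph_count_eq C.T_def X_def case_prod_beta)
      (simp add: J_def k_def)
  have mean: "expectation (\<lambda>\<omega>. C.T (X \<omega>)) = C.expect C.T"
    unfolding X_def by (rule expectation_bernoulli_set[OF law])
  have var: "expectation (\<lambda>\<omega>. (C.T (X \<omega>) - C.expect C.T)\<^sup>2) = C.var_T"
    unfolding X_def C.var_T_def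
    by (rule expectation_bernoulli_set[OF law, where G = "\<lambda>A. (C.T A - C.expect C.T)\<^sup>2"])
  have prob: "measure M {\<omega> \<in> space M. standardized M (inj_subgraph_count V E n \<xi>) \<omega> \<le> z} =
      C.expect (\<lambda>A. of_bool ((C.T A - C.expect C.T) / sqrt C.var_T \<le> z))"
    unfolding standardized_def T mean var unfolding X_def
    by (rule prob_bernoulli_set[OF law, where P = "\<lambda>A. (C.T A - C.expect C.T) / sqrt C.var_T \<le> z"])

  have var_lower: "d * real n ^ (2 * k) / (real n)\<^sup>2 \<le> C.var_T"
  proof -
    have "(1, 2) \<in> node_pairs n"
      using k2 nk by (simp add: node_pairs_def)
    then have ne: "node_pairs n \<noteq> {}" by blast
    \<comment> \<open>As \<open>k \<le> n\<close>, the integer quotient is at least 1 and rounding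
      down loses at most a factor 2.\<close>
    have "real n / (2 * k) \<le> real (n div k)"
    proof -
      have "n < k * (n div k) + k"
        using k2 mod_less_divisor[of k n] mult_div_mod_eq[of k n] by linarith
      moreover have "k * 1 \<le> k * (n div k)"
        using k2 nk by (intro mult_left_mono) (auto simp: Suc_le_eq div_greater_zero_iff)
      moreover have "n div k * (2 * k) = k * (n div k) + k * (n div k)"
        by simp
      ultimately have "n \<le> n div k * (2 * k)" by linarith
      then have "real n \<le> real (n div k) * (2 * real k)"
        by (metis of_nat_le_iff of_nat_mult of_nat_numeral)
      then show ?thesis using k2 by (simp add: divide_le_eq)
    qed
    then have "(real n / (2 * k)) ^ k \<le> real (n div k) ^ k"
      by (rule power_mono) simp
    also have "\<dots> \<le> real (card J)"
    proof -
      have "1 \<le> card (copies V E)"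
        using copies_nonempty[OF graph(1)] finite_copies by (simp add: Suc_le_eq card_gt_0_iff)
      then have "(n div k) ^ k * 1 \<le> card J"
        unfolding J_def card_cartesian_product by (intro mult_mono card_increasing_tuples_ge) auto
      then show ?thesis by (metis mult_1_right of_nat_le_iff of_nat_power)
    qed
    finally have "((real n / (2 * k)) ^ k)\<^sup>2 \<le> (real (card J))\<^sup>2"
      by (rule power_mono) simp
    moreover have "((real n / (2 * k)) ^ k)\<^sup>2 = real n ^ (2 * k) / (2 * real k) ^ (2 * k)"
      by (simp only: power_divide power_even_eq of_nat_mult of_nat_numeral)
    ultimately have J2: "real n ^ (2 * k) / (2 * real k) ^ (2 * k) \<le> (real (card J))\<^sup>2"
      by (simp only:)
    have S: "0 < real (card (node_pairs n))" "real (card (node_pairs n)) \<le> (real n)\<^sup>2"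
      using ne finite_node_pairs card_node_pairs_le[of n]
      by (auto simp: card_gt_0_iff simp flip: of_nat_power)
    have "d * real n ^ (2 * k) / (real n)\<^sup>2 =
        (1 - p) * p ^ (2 * k\<^sup>2) * (real n ^ (2 * k) / (2 * real k) ^ (2 * k)) / (real n)\<^sup>2"
      by (simp add: d_def)
    also have "\<dots> \<le> (1 - p) * p ^ (2 * k\<^sup>2) * (real (card J))\<^sup>2 / card (node_pairs n)"
      using p J2 S by (intro frac_le mult_left_mono mult_nonneg_nonneg) auto
    also have "\<dots> \<le> C.var_T"
      using placed_edges_nonempty[OF graph] card_placed_edges_le[of _ V E] ne
      by (intro C.var_T_lower_bound) (auto simp: J_def k_def)
    finally show ?thesis .
  qed
  have d: "0 < d" using p k2 by (simp add: d_def)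
  have lower_pos: "0 < d * real n ^ (2 * k) / (real n)\<^sup>2" using d n0 by simp
  have "\<bar>measure M {\<omega> \<in> space M. standardized M (inj_subgraph_count V E n \<xi>) \<omega> \<le> z} - std_normal_cdf z\<bar>
      \<le> 4 * (1 + 2 * real (k\<^sup>2)) * sqrt (card (node_pairs n)) * (c * real n ^ (k - 2))\<^sup>2 / C.var_T"
    unfolding prob using var_lower lower_pos by (intro C.kolmogorov_bound) linarith
  also have "\<dots> \<le> 4 * (1 + 2 * real (k\<^sup>2)) * n * (c * real n ^ (k - 2))\<^sup>2
      / (d * real n ^ (2 * k) / (real n)\<^sup>2)"
  proof (intro frac_le mult_right_mono mult_left_mono var_lower lower_pos)
    have "real (card (node_pairs n)) \<le> (real n)\<^sup>2"
      using card_node_pairs_le[of n] by (simp flip: of_nat_power)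
    then show "sqrt (card (node_pairs n)) \<le> real n"
      by (rule real_le_lsqrt[rotated]) simp
  qed auto
  also have "\<dots> = 4 * (1 + 2 * real (k\<^sup>2)) * c\<^sup>2 / d / n"
  proof -
    \<comment> \<open>Expressing all powers of \<open>n\<close> through \<open>y\<close> lets them
      cancel without subtraction in exponents.\<close>
    define y where "y = real n ^ (k - 2)"
    define K where "K = 4 * (1 + 2 * real (k\<^sup>2))"
    have "y * (real n)\<^sup>2 = real n ^ k"
      by (simp only: y_def power_add[symmetric] le_add_diff_inverse2[OF k2])
    then have "real n ^ (2 * k) = (y * (real n)\<^sup>2)\<^sup>2"
      by (simp only: power_even_eq)
    moreover have "K * n * (c * y)\<^sup>2 / (d * (y * (real n)\<^sup>2)\<^sup>2 / (real n)\<^sup>2) = K * c\<^sup>2 / d / n"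
    proof -
      have "y \<noteq> 0" using n0 by (simp add: y_def)
      then show ?thesis
        using n0 d by (simp add: field_simps power2_eq_square)
    qed
    ultimately show ?thesis by (simp only: y_def K_def)
  qed
  finally show ?thesis .
qed

theorem theorem3p2:
  fixes V :: "'v set" and E :: "'v set set" and p :: real
  assumes "simple_graph V E" and "E \<noteq> {}"
    and "0 < p" and "p < 1"
  shows "\<exists>C::real. \<forall>n\<ge>1. \<forall>(M :: 'a measure) \<xi>. erdos_renyi n p M \<xi> \<longrightarrow>
    (SUP z::real. \<bar>measure M {\<omega> \<in> space M.
         standardized M (inj_subgraph_count V E n \<xi>) \<omega> \<le> z} - std_normal_cdf z\<bar>)
      \<le> C / real n"
proof -
  define k where "k = card V"
  define c where "c = real (k\<^sup>2 * card (copies V E))"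
  define d where "d = (1 - p) * p ^ (2 * k\<^sup>2) / (2 * real k) ^ (2 * k)"
  define B where "B = 4 * (1 + 2 * real (k\<^sup>2)) * c\<^sup>2 / d"
  have "0 \<le> B" using assms(3,4) by (simp add: B_def d_def)
  \<comment> \<open>\<open>B\<close> serves all \<open>n \<ge> k\<close>. The added \<open>k\<close>
    covers smaller \<open>n\<close>, where the distance is at most 1 and hence at most
    \<open>k / n\<close>.\<close>
  show ?thesis
  proof (intro exI[of _ "B + k"] allI impI cSUP_least)
    fix n :: nat and M :: "'a measure" and \<xi> z
    assume n: "1 \<le> n" and ER: "erdos_renyi n p M \<xi>"
    interpret prob_space M using ER by (simp add: erdos_renyi_def)
    let ?D = "\<bar>measure M {\<omega> \<in> space M.
         standardized M (inj_subgraph_count V E n \<xi>) \<omega> \<le> z} - std_normal_cdf z\<bar>"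
    show "?D \<le> (B + k) / real n"
    proof (cases "k \<le> n")
      case True
      then have "?D \<le> B / n"
        using inj_subgraph_count_kolmogorov[OF assms ER] by (simp add: B_def c_def d_def k_def)
      also have "\<dots> \<le> (B + k) / n" by (intro divide_right_mono) auto
      finally show ?thesis .
    next
      case False
      have "?D \<le> 1"
        using std_normal_cdf_nonneg[of z] std_normal_cdf_le_1[of z]
          prob_le_1[of "{\<omega> \<in> space M. standardized M (inj_subgraph_count V E n \<xi>) \<omega> \<le> z}"]
          measure_nonneg[of M "{\<omega> \<in> space M. standardized M (inj_subgraph_count V E n \<xi>) \<omega> \<le> z}"]
        by linarith
      also have "\<dots> \<le> (B + k) / n"
        using False n \<open>0 \<le> B\<close> by (simp add: le_divide_eq)
      finally show ?thesis .
    qed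
  qed simp
qed

end
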